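(* Let $\alpha\in(0,1/2)$. There exist constants $C=C(\alpha)>0$ and $\lambda_0=\lambda_0(\alpha)\ge 1$, depending only on $\alpha$, such that for all functions $u\in H_0^2(R)$ and all $\lambda\ge\lambda_0$ the following Carleman estimate holds: $$\begin{aligned}\int_R (u_{xx}-2u_{xt})^2\varphi_\lambda\,dxdt\ \ge\ & C\lambda\int_R (u_x^2+u_t^2)\varphi_\lambda\,dxdt+C\lambda^3\int_R u^2\varphi_\lambda\,dxdt\\ &+C\lambda\int_0^1 u_x^2(x,0)e^{-2\lambda x}dx+C\lambda^3\int_0^1 u^2(x,0)e^{-2\lambda x}dx\\ &-C\lambda e^{-2\lambda\alpha T}\int_0^1 u_x^2(x,T)dx-C\lambda^3e^{-2\lambda\alpha T}\int_0^1u^2(x,T)dx.\end{aligned}$$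
   Context: $R=(0,1)\times(0,T)$ with $T\ge 2$; points of $R$ are denoted $(x,t)$. The Carleman Weight Function is $\varphi_\lambda(x,t)=\exp(-2\lambda(x+\alpha t))$. All functions are real valued. $H_0^2(R)=\{u\in H^2(R): u(0,t)=u_x(0,t)=0\}$ (traces on $\{x=0\}$); note that no condition is imposed on the other sides of $R$. Values at $t=0$ and $t=T$ are understood as traces. *)

theory Defs
  imports "HOL-Analysis.Analysis"
begin

text \<open>Points of the plane are pairs \<open>(x, t)\<close>.  Equivalence classes of square integrable functions
  are handled through Borel measurable representatives.\<close>

definition rect :: "real \<Rightarrow> (real \<times> real) set" where
  "rect T = {0<..<1} \<times> {0<..<T}"

definition carleman_weight :: "real \<Rightarrow> real \<Rightarrow> real \<times> real \<Rightarrow> real" where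
  "carleman_weight \<alpha> lam p = exp (- 2 * lam * (fst p + \<alpha> * snd p))"

definition L2_on :: "'a::euclidean_space set \<Rightarrow> ('a \<Rightarrow> real) \<Rightarrow> bool" where
  "L2_on S f \<longleftrightarrow> set_borel_measurable lborel S f \<and> set_integrable lborel S (\<lambda>p. (f p)\<^sup>2)"

definition L2_tendsto ::
  "'a::euclidean_space set \<Rightarrow> (nat \<Rightarrow> 'a \<Rightarrow> real) \<Rightarrow> ('a \<Rightarrow> real) \<Rightarrow> bool" where
  "L2_tendsto S w f \<longleftrightarrow> (\<lambda>n. LINT p:S|lborel. (w n p - f p)\<^sup>2) \<longlonglongrightarrow> 0"


subsection \<open>Classical derivatives and smooth functions on the plane\<close>

definition pd_x :: "(real \<times> real \<Rightarrow> real) \<Rightarrow> real \<times> real \<Rightarrow> real" where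
  "pd_x f p = deriv (\<lambda>x. f (x, snd p)) (fst p)"

definition pd_t :: "(real \<times> real \<Rightarrow> real) \<Rightarrow> real \<times> real \<Rightarrow> real" where
  "pd_t f p = deriv (\<lambda>t. f (fst p, t)) (snd p)"

primrec C_k :: "nat \<Rightarrow> (real \<times> real \<Rightarrow> real) \<Rightarrow> bool" where
  "C_k 0 f \<longleftrightarrow> continuous_on UNIV f"
| "C_k (Suc k) f \<longleftrightarrow>
     (\<forall>x t. (\<lambda>y. f (y, t)) differentiable (at x) \<and> (\<lambda>s. f (x, s)) differentiable (at t)) \<and>
     C_k k (pd_x f) \<and> C_k k (pd_t f)"

definition smooth :: "(real \<times> real \<Rightarrow> real) \<Rightarrow> bool" where
  "smooth f \<longleftrightarrow> (\<forall>k. C_k k f)"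

definition test_function :: "(real \<times> real) set \<Rightarrow> (real \<times> real \<Rightarrow> real) \<Rightarrow> bool" where
  "test_function \<Omega> \<psi> \<longleftrightarrow>
     smooth \<psi> \<and> (\<exists>K. compact K \<and> K \<subseteq> \<Omega> \<and> (\<forall>p. p \<notin> K \<longrightarrow> \<psi> p = 0))"


subsection \<open>Weak derivatives and Sobolev spaces\<close>

definition has_weak_x ::
  "(real \<times> real) set \<Rightarrow> (real \<times> real \<Rightarrow> real) \<Rightarrow> (real \<times> real \<Rightarrow> real) \<Rightarrow> bool" where
  "has_weak_x \<Omega> u v \<longleftrightarrow> L2_on \<Omega> v \<and>
     (\<forall>\<psi>. test_function \<Omega> \<psi> \<longrightarrow>
        (LINT p:\<Omega>|lborel. u p * pd_x \<psi> p) = - (LINT p:\<Omega>|lborel. v p * \<psi> p))"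

definition has_weak_t ::
  "(real \<times> real) set \<Rightarrow> (real \<times> real \<Rightarrow> real) \<Rightarrow> (real \<times> real \<Rightarrow> real) \<Rightarrow> bool" where
  "has_weak_t \<Omega> u v \<longleftrightarrow> L2_on \<Omega> v \<and>
     (\<forall>\<psi>. test_function \<Omega> \<psi> \<longrightarrow>
        (LINT p:\<Omega>|lborel. u p * pd_t \<psi> p) = - (LINT p:\<Omega>|lborel. v p * \<psi> p))"

text \<open>Weak derivatives are unique up to null sets; the operators below choose a representative.\<close>

definition wd_x :: "(real \<times> real) set \<Rightarrow> (real \<times> real \<Rightarrow> real) \<Rightarrow> real \<times> real \<Rightarrow> real" where
  "wd_x \<Omega> u = (SOME v. has_weak_x \<Omega> u v)"

definition wd_t :: "(real \<times> real) set \<Rightarrow> (real \<times> real \<Rightarrow> real) \<Rightarrow> real \<times> real \<Rightarrow> real" where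
  "wd_t \<Omega> u = (SOME v. has_weak_t \<Omega> u v)"

definition H1 :: "(real \<times> real) set \<Rightarrow> (real \<times> real \<Rightarrow> real) set" where
  "H1 \<Omega> = {u. L2_on \<Omega> u \<and> (\<exists>v. has_weak_x \<Omega> u v) \<and> (\<exists>v. has_weak_t \<Omega> u v)}"

definition H2 :: "(real \<times> real) set \<Rightarrow> (real \<times> real \<Rightarrow> real) set" where
  "H2 \<Omega> = {u \<in> H1 \<Omega>. wd_x \<Omega> u \<in> H1 \<Omega> \<and> wd_t \<Omega> u \<in> H1 \<Omega>}"

definition H1_tendsto ::
  "(real \<times> real) set \<Rightarrow> (nat \<Rightarrow> real \<times> real \<Rightarrow> real) \<Rightarrow> (real \<times> real \<Rightarrow> real) \<Rightarrow> bool" where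
  "H1_tendsto \<Omega> w u \<longleftrightarrow>
     L2_tendsto \<Omega> w u \<and>
     L2_tendsto \<Omega> (\<lambda>n. pd_x (w n)) (wd_x \<Omega> u) \<and>
     L2_tendsto \<Omega> (\<lambda>n. pd_t (w n)) (wd_t \<Omega> u)"


subsection \<open>Traces on the sides of the rectangle\<close>

text \<open>The trace operator is the continuous extension, from functions smooth up to the boundary
  to \<open>H1\<close>, of the restriction to a side (here parametrised by \<open>\<gamma>\<close> on the interval \<open>I\<close>);
  \<open>has_trace\<close> is the graph of this extension, a trace being determined up to null sets.\<close>

definition has_trace ::
  "(real \<times> real) set \<Rightarrow> (real \<Rightarrow> real \<times> real) \<Rightarrow> real set \<Rightarrow>
   (real \<times> real \<Rightarrow> real) \<Rightarrow> (real \<Rightarrow> real) \<Rightarrow> bool" where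
  "has_trace \<Omega> \<gamma> I u g \<longleftrightarrow> u \<in> H1 \<Omega> \<and> L2_on I g \<and>
     (\<exists>w. (\<forall>n. smooth (w n)) \<and> H1_tendsto \<Omega> w u \<and> L2_tendsto I (\<lambda>n s. w n (\<gamma> s)) g)"

definition has_left_trace :: "real \<Rightarrow> (real \<times> real \<Rightarrow> real) \<Rightarrow> (real \<Rightarrow> real) \<Rightarrow> bool" where
  "has_left_trace T = has_trace (rect T) (\<lambda>t. (0, t)) {0<..<T}"

definition trace_at_time ::
  "real \<Rightarrow> real \<Rightarrow> (real \<times> real \<Rightarrow> real) \<Rightarrow> real \<Rightarrow> real" where
  "trace_at_time T \<tau> u = (SOME g. has_trace (rect T) (\<lambda>x. (x, \<tau>)) {0<..<1} u g)"

definition H2_0 :: "real \<Rightarrow> (real \<times> real \<Rightarrow> real) set" where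
  "H2_0 T = {u \<in> H2 (rect T).
     has_left_trace T u (\<lambda>_. 0) \<and> has_left_trace T (wd_x (rect T) u) (\<lambda>_. 0)}"

end

theory Submission
  imports Defs
begin

text \<open>The operator \<open>\<partial>\<^sub>x\<^sup>2 - 2 \<partial>\<^sub>x \<partial>\<^sub>t\<close> is a product of two transport operators, \<open>\<partial>\<^sub>x\<close> and \<open>\<partial>\<^sub>x - 2 \<partial>\<^sub>t\<close>.  Along
  both directions the exponent \<open>x + \<alpha> t\<close> of the weight grows, at the rates \<open>1\<close> and \<open>\<kappa> = 1 - 2 \<alpha> > 0\<close>.
  For a first order operator this gives a Carleman estimate by completing a square
  (\<open>transport_estimate\<close>): the derivative along the direction dominates \<open>lam\<close> times the function, and the
  boundary terms on \<open>x = 1\<close> and \<open>t = 0\<close> have the good sign.  The side \<open>x = 0\<close> costs nothing because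
  \<open>u\<close> and its derivative in \<open>x\<close> vanish there; the side \<open>t = T\<close> contributes the negative terms of the
  theorem.

  With \<open>w = u\<^sub>x - 2 u\<^sub>t\<close> the second order expression is both \<open>w\<^sub>x\<close> and \<open>(\<partial>\<^sub>x - 2 \<partial>\<^sub>t) u\<^sub>x\<close>.  The first
  form bounds \<open>w\<close>, and then \<open>u\<close> through \<open>w = (\<partial>\<^sub>x - 2 \<partial>\<^sub>t) u\<close>; the second bounds \<open>u\<^sub>x\<close>; and
  \<open>u\<^sub>t = (u\<^sub>x - w) / 2\<close>.  Adding the three estimates proves the theorem for smooth \<open>u\<close> with \<open>u = 0\<close> on
  \<open>x = 0\<close>, up to the norm of \<open>u\<^sub>x\<close> on that side (\<open>smooth_carleman_estimate\<close>), with constants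
  \<open>C = \<kappa> / 2\<close> and \<open>lam0 = 3 / \<kappa>\<close>.

  The passage to \<open>H2\<close> starts from the vanishing traces, each of which comes with an approximating
  sequence of smooth functions.  The sequences for \<open>u\<close> and for \<open>u\<^sub>x\<close> are replaced by a single one: if
  \<open>v n\<close> approximates \<open>u\<^sub>x\<close>, then the primitives of \<open>v n\<close> from \<open>x = 0\<close> approximate \<open>u\<close> together with all
  the derivatives in the estimate (\<open>H2_0_approximation\<close>).  A trace inequality identifies the
  traces at \<open>t = 0\<close> and \<open>t = T\<close> with the limits of the restrictions (\<open>trace_at_time_limit\<close>), and
  every term of the smooth estimate converges.\<close>

section \<open>Square integrable functions\<close>

definition sqnorm :: "'a::euclidean_space set \<Rightarrow> ('a \<Rightarrow> real) \<Rightarrow> real" where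
  "sqnorm S f = (LINT p:S|lborel. (f p)\<^sup>2)"

lemma L2_tendsto_sqnorm: "L2_tendsto S w f \<longleftrightarrow> (\<lambda>n. sqnorm S (\<lambda>p. w n p - f p)) \<longlonglongrightarrow> 0"
  by (simp add: L2_tendsto_def sqnorm_def)

lemma tendsto_zero_squeeze:
  fixes a b :: "nat \<Rightarrow> real"
  assumes "\<And>n. 0 \<le> a n" "\<And>n. a n \<le> b n" "b \<longlonglongrightarrow> 0"
  shows "a \<longlonglongrightarrow> 0"
  by (rule tendsto_sandwich[OF _ _ tendsto_const assms(3)]) (use assms in auto)

lemma set_integral_nonneg_real:
  fixes f :: "'a \<Rightarrow> real"
  assumes "\<And>p. p \<in> S \<Longrightarrow> 0 \<le> f p"
  shows "0 \<le> (LINT p:S|M. f p)"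
  unfolding set_lebesgue_integral_def
  by (intro integral_nonneg_AE AE_I2) (auto simp: indicator_def assms)

lemma sqnorm_nonneg: "0 \<le> sqnorm S f"
  unfolding sqnorm_def by (rule set_integral_nonneg_real) simp

lemma L2_on_restrict:
  assumes "S \<in> sets borel"
  shows "L2_on S f \<longleftrightarrow> f \<in> borel_measurable (restrict_space lborel S) \<and>
           integrable (restrict_space lborel S) (\<lambda>p. (f p)\<^sup>2)"
  using assms by (simp add: L2_on_def set_borel_measurable_def set_integrable_def
      borel_measurable_restrict_space_iff integrable_restrict_space)

lemma set_integrable_restrict:
  fixes f :: "'a::euclidean_space \<Rightarrow> real"
  assumes "S \<in> sets borel"
  shows "set_integrable lborel S f \<longleftrightarrow> integrable (restrict_space lborel S) f"
  using assms by (simp add: set_integrable_def integrable_restrict_space)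

lemma L2_on_mult_integrable:
  assumes S: "S \<in> sets borel" and f: "L2_on S f" and g: "L2_on S g"
  shows "set_integrable lborel S (\<lambda>p. f p * g p)"
proof -
  let ?M = "restrict_space lborel S"
  have [measurable]: "f \<in> borel_measurable ?M" "g \<in> borel_measurable ?M"
    using f g S by (auto simp: L2_on_restrict)
  have i: "integrable ?M (\<lambda>p. (f p)\<^sup>2 + (g p)\<^sup>2)"
    using f g S by (auto simp: L2_on_restrict)
  have "integrable ?M (\<lambda>p. f p * g p)"
  proof (rule Bochner_Integration.integrable_bound[OF i])
    show "AE p in ?M. norm (f p * g p) \<le> norm ((f p)\<^sup>2 + (g p)\<^sup>2)"
    proof (rule AE_I2)
      fix p
      have "0 \<le> (\<bar>f p\<bar> - \<bar>g p\<bar>)\<^sup>2" by simp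
      then have "2 * (\<bar>f p\<bar> * \<bar>g p\<bar>) \<le> (f p)\<^sup>2 + (g p)\<^sup>2"
        by (simp add: power2_diff)
      moreover have "0 \<le> \<bar>f p\<bar> * \<bar>g p\<bar>" by simp
      ultimately have "\<bar>f p\<bar> * \<bar>g p\<bar> \<le> (f p)\<^sup>2 + (g p)\<^sup>2" by linarith
      then show "norm (f p * g p) \<le> norm ((f p)\<^sup>2 + (g p)\<^sup>2)" by (simp add: abs_mult)
    qed
  qed measurable
  then show ?thesis using S by (simp add: set_integrable_restrict)
qed

lemma L2_on_cmult:
  assumes S: "S \<in> sets borel" and f: "L2_on S f"
  shows "L2_on S (\<lambda>p. c * f p)"
  using f by (auto simp: L2_on_restrict[OF S] power_mult_distrib)

lemma L2_on_add:
  assumes S: "S \<in> sets borel" and f: "L2_on S f" and g: "L2_on S g"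
  shows "L2_on S (\<lambda>p. f p + g p)"
proof -
  have "integrable (restrict_space lborel S) (\<lambda>p. (f p)\<^sup>2 + (g p)\<^sup>2 + 2 * (f p * g p))"
    using f g L2_on_mult_integrable[OF S f g]
    by (auto simp: L2_on_restrict[OF S] set_integrable_restrict[OF S])
  moreover have "(\<lambda>p. (f p + g p)\<^sup>2) = (\<lambda>p. (f p)\<^sup>2 + (g p)\<^sup>2 + 2 * (f p * g p))"
    by (auto simp: power2_sum)
  ultimately show ?thesis using f g by (auto simp: L2_on_restrict[OF S])
qed

lemma L2_on_diff:
  assumes S: "S \<in> sets borel" and f: "L2_on S f" and g: "L2_on S g"
  shows "L2_on S (\<lambda>p. f p - g p)"
  using L2_on_add[OF S f L2_on_cmult[OF S g, of "-1"]] by simp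

lemma sqnorm_cmult: "sqnorm S (\<lambda>p. c * f p) = c\<^sup>2 * sqnorm S f"
  by (simp add: sqnorm_def power_mult_distrib)

text \<open>The factor \<open>2\<close> replaces the triangle inequality: convergence to zero and Cauchy conditions
  do not see it, and square roots are avoided.\<close>

lemma sqnorm_add_le:
  assumes S: "S \<in> sets borel" and f: "L2_on S f" and g: "L2_on S g"
  shows "sqnorm S (\<lambda>p. f p + g p) \<le> 2 * sqnorm S f + 2 * sqnorm S g"
proof -
  note fg = L2_on_add[OF S f g]
  have "sqnorm S (\<lambda>p. f p + g p) \<le> (LINT p:S|lborel. 2 * (f p)\<^sup>2 + 2 * (g p)\<^sup>2)"
    unfolding sqnorm_def
  proof (rule set_integral_mono)
    show "set_integrable lborel S (\<lambda>p. 2 * (f p)\<^sup>2 + 2 * (g p)\<^sup>2)"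
      using f g by (intro set_integral_add) (auto simp: L2_on_def)
    fix p
    show "(f p + g p)\<^sup>2 \<le> 2 * (f p)\<^sup>2 + 2 * (g p)\<^sup>2"
      using zero_le_power2[of "f p - g p"] by (simp add: power2_sum power2_diff)
  qed (use fg in \<open>auto simp: L2_on_def\<close>)
  also have "\<dots> = 2 * sqnorm S f + 2 * sqnorm S g"
    unfolding sqnorm_def using f g by (subst set_integral_add) (auto simp: L2_on_def)
  finally show ?thesis .
qed

lemma sqnorm_diff_le:
  assumes S: "S \<in> sets borel" and f: "L2_on S f" and g: "L2_on S g"
  shows "sqnorm S (\<lambda>p. f p - g p) \<le> 2 * sqnorm S f + 2 * sqnorm S g"
  using sqnorm_add_le[OF S f L2_on_cmult[OF S g, of "-1"]] sqnorm_cmult[of S "-1" g] by simp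

lemma L2_tendsto_perturb:
  assumes S: "S \<in> sets borel" and w: "\<And>n. L2_on S (w n)" and z: "\<And>n. L2_on S (z n)"
    and f: "L2_on S f" and lim: "L2_tendsto S w f"
    and diff: "(\<lambda>n. sqnorm S (\<lambda>p. z n p - w n p)) \<longlonglongrightarrow> 0"
  shows "L2_tendsto S z f"
  unfolding L2_tendsto_sqnorm
proof (rule tendsto_zero_squeeze[OF sqnorm_nonneg])
  show "(\<lambda>n. 2 * sqnorm S (\<lambda>p. z n p - w n p) + 2 * sqnorm S (\<lambda>p. w n p - f p)) \<longlonglongrightarrow> 0"
    using tendsto_add[OF tendsto_mult_right_zero[OF diff, of 2]
        tendsto_mult_right_zero[OF lim[unfolded L2_tendsto_sqnorm], of 2]] by simp
  show "sqnorm S (\<lambda>p. z n p - f p)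
      \<le> 2 * sqnorm S (\<lambda>p. z n p - w n p) + 2 * sqnorm S (\<lambda>p. w n p - f p)" for n
    using sqnorm_add_le[OF S L2_on_diff[OF S z[of n] w[of n]] L2_on_diff[OF S w[of n] f]] by simp
qed

lemma L2_tendsto_diff_zero:
  assumes S: "S \<in> sets borel" and w: "\<And>n. L2_on S (w n)" and z: "\<And>n. L2_on S (z n)"
    and f: "L2_on S f" and lim: "L2_tendsto S w f" "L2_tendsto S z f"
  shows "(\<lambda>n. sqnorm S (\<lambda>p. w n p - z n p)) \<longlonglongrightarrow> 0"
proof (rule tendsto_zero_squeeze[OF sqnorm_nonneg])
  show "(\<lambda>n. 2 * sqnorm S (\<lambda>p. w n p - f p) + 2 * sqnorm S (\<lambda>p. z n p - f p)) \<longlonglongrightarrow> 0"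
    using tendsto_add[OF tendsto_mult_right_zero[OF lim(1)[unfolded L2_tendsto_sqnorm], of 2]
        tendsto_mult_right_zero[OF lim(2)[unfolded L2_tendsto_sqnorm], of 2]] by simp
  show "sqnorm S (\<lambda>p. w n p - z n p)
      \<le> 2 * sqnorm S (\<lambda>p. w n p - f p) + 2 * sqnorm S (\<lambda>p. z n p - f p)" for n
    using sqnorm_diff_le[OF S L2_on_diff[OF S w[of n] f] L2_on_diff[OF S z[of n] f]] by simp
qed

lemma L2_tendsto_Cauchy:
  assumes S: "S \<in> sets borel" and w: "\<And>n. L2_on S (w n)"
    and f: "L2_on S f" and lim: "L2_tendsto S w f" and e: "0 < e"
  shows "\<exists>N. \<forall>m\<ge>N. \<forall>n\<ge>N. sqnorm S (\<lambda>p. w m p - w n p) < e"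
proof -
  obtain N where N: "\<And>n. n \<ge> N \<Longrightarrow> sqnorm S (\<lambda>p. w n p - f p) < e / 4"
    using LIMSEQ_D[OF lim[unfolded L2_tendsto_sqnorm], of "e / 4"] e
    by (auto simp: sqnorm_nonneg)
  have "sqnorm S (\<lambda>p. w m p - w n p) < e" if "m \<ge> N" "n \<ge> N" for m n
    using sqnorm_diff_le[OF S L2_on_diff[OF S w f, of m] L2_on_diff[OF S w f, of n]]
      N[OF that(1)] N[OF that(2)] by simp
  then show ?thesis by blast
qed

lemma L2_tendsto_lincomb:
  assumes S: "S \<in> sets borel" and w: "\<And>n. L2_on S (w n)" and z: "\<And>n. L2_on S (z n)"
    and f: "L2_on S f" and g: "L2_on S g" and lim: "L2_tendsto S w f" "L2_tendsto S z g"
  shows "L2_tendsto S (\<lambda>n p. w n p + c * z n p) (\<lambda>p. f p + c * g p)"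
  unfolding L2_tendsto_sqnorm
proof (rule tendsto_zero_squeeze[OF sqnorm_nonneg])
  show "(\<lambda>n. 2 * sqnorm S (\<lambda>p. w n p - f p) + 2 * (c\<^sup>2 * sqnorm S (\<lambda>p. z n p - g p))) \<longlonglongrightarrow> 0"
    using lim unfolding L2_tendsto_sqnorm by (intro tendsto_add_zero tendsto_mult_right_zero)
  fix n
  have "(\<lambda>p. w n p + c * z n p - (f p + c * g p)) = (\<lambda>p. (w n p - f p) + c * (z n p - g p))"
    by (simp add: algebra_simps)
  then show "sqnorm S (\<lambda>p. w n p + c * z n p - (f p + c * g p))
      \<le> 2 * sqnorm S (\<lambda>p. w n p - f p) + 2 * (c\<^sup>2 * sqnorm S (\<lambda>p. z n p - g p))"
    using sqnorm_add_le[OF S L2_on_diff[OF S w f, of n] L2_on_cmult[OF S L2_on_diff[OF S z g, of n], of c]]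
    by (simp add: sqnorm_cmult)
qed


text \<open>The limiting form of the Cauchy-Schwarz inequality, from \<open>\<bar>f g\<bar> \<le> f\<^sup>2 / e + e g\<^sup>2\<close>.\<close>

lemma L2_product_tendsto_zero:
  assumes S: "S \<in> sets borel" and f: "\<And>n. L2_on S (f n)" and g: "L2_on S g"
    and lim: "(\<lambda>n. sqnorm S (f n)) \<longlonglongrightarrow> 0"
  shows "(\<lambda>n. LINT p:S|lborel. f n p * g p) \<longlonglongrightarrow> 0"
proof -
  define s where "s n = sqrt (sqnorm S (f n))" for n
  \<comment> \<open>The optimal parameter in Young's inequality is of the size of \<open>s n\<close>, which may be zero; the
    added null sequence keeps it positive.\<close>
  define e where "e n = s n + inverse (real (Suc n))" for n
  have s0: "0 \<le> s n" for n by (simp add: s_def sqnorm_nonneg)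
  have e0: "0 < e n" for n using s0[of n] by (simp add: e_def add_nonneg_pos)
  have slim: "s \<longlonglongrightarrow> 0" using tendsto_real_sqrt[OF lim] by (simp add: s_def[abs_def])
  then have elim: "e \<longlonglongrightarrow> 0"
    using tendsto_add[OF slim LIMSEQ_inverse_real_of_nat] by (simp add: e_def[abs_def])
  have bnd: "\<bar>LINT p:S|lborel. f n p * g p\<bar> \<le> s n + e n * sqnorm S g" for n
  proof -
    note fg = L2_on_mult_integrable[OF S f g, of n]
    have "\<bar>LINT p:S|lborel. f n p * g p\<bar> \<le> (LINT p:S|lborel. \<bar>f n p * g p\<bar>)"
      using set_integral_norm_bound[OF fg] by simp
    also have "\<dots> \<le> (LINT p:S|lborel. inverse (e n) * (f n p)\<^sup>2 + e n * (g p)\<^sup>2)"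
    proof (rule set_integral_mono)
      show "set_integrable lborel S (\<lambda>p. \<bar>f n p * g p\<bar>)" using fg by (rule set_integrable_abs)
      show "set_integrable lborel S (\<lambda>p. inverse (e n) * (f n p)\<^sup>2 + e n * (g p)\<^sup>2)"
        using f g by (intro set_integral_add) (auto simp: L2_on_def)
      fix p
      let ?a = "\<bar>f n p\<bar>" and ?b = "\<bar>g p\<bar>"
      have "0 \<le> (?a - e n * ?b)\<^sup>2 + e n * (?a * ?b)" using e0[of n] by simp
      then have "e n * (?a * ?b) \<le> ?a\<^sup>2 + (e n)\<^sup>2 * ?b\<^sup>2"
        by (simp add: power2_diff power_mult_distrib algebra_simps)
      then have "inverse (e n) * (e n * (?a * ?b)) \<le> inverse (e n) * (?a\<^sup>2 + (e n)\<^sup>2 * ?b\<^sup>2)"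
        using e0[of n] by (intro mult_left_mono) auto
      then show "\<bar>f n p * g p\<bar> \<le> inverse (e n) * (f n p)\<^sup>2 + e n * (g p)\<^sup>2"
        using e0[of n] by (simp add: abs_mult distrib_left power2_eq_square mult.assoc[symmetric])
    qed
    also have "\<dots> = inverse (e n) * sqnorm S (f n) + e n * sqnorm S g"
      using f g by (simp add: sqnorm_def L2_on_def set_integral_add)
    also have "inverse (e n) * sqnorm S (f n) \<le> s n"
    proof -
      have "sqnorm S (f n) = s n * s n" by (simp add: s_def sqnorm_nonneg)
      also have "\<dots> \<le> e n * s n" using s0[of n] by (intro mult_right_mono) (auto simp: e_def)
      finally show ?thesis using e0[of n] by (simp add: field_simps)
    qed
    finally show ?thesis by simp
  qed
  have "(\<lambda>n. s n + e n * sqnorm S g) \<longlonglongrightarrow> 0"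
    using tendsto_add[OF slim tendsto_mult_left_zero[OF elim, of "sqnorm S g"]] by simp
  then have "(\<lambda>n. \<bar>LINT p:S|lborel. f n p * g p\<bar>) \<longlonglongrightarrow> 0"
    by (rule tendsto_zero_squeeze[OF abs_ge_zero bnd])
  then show ?thesis by (rule tendsto_rabs_zero_cancel)
qed


lemma L2_on_weight_integrable:
  assumes S: "S \<in> sets borel" and f: "L2_on S f" and q: "q \<in> borel_measurable borel"
    and b: "\<And>p. p \<in> S \<Longrightarrow> \<bar>q p\<bar> \<le> B"
  shows "set_integrable lborel S (\<lambda>p. (f p)\<^sup>2 * q p)"
proof -
  let ?M = "restrict_space lborel S"
  have [measurable]: "f \<in> borel_measurable ?M" using f S by (auto simp: L2_on_restrict)
  have [measurable]: "q \<in> borel_measurable ?M"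
    using q by (simp add: measurable_restrict_space1)
  have i: "integrable ?M (\<lambda>p. B * (f p)\<^sup>2)" using f S by (auto simp: L2_on_restrict)
  have "integrable ?M (\<lambda>p. (f p)\<^sup>2 * q p)"
  proof (rule Bochner_Integration.integrable_bound[OF i])
    show "AE p in ?M. norm ((f p)\<^sup>2 * q p) \<le> norm (B * (f p)\<^sup>2)"
    proof (rule AE_I2)
      fix p assume "p \<in> space ?M"
      then have "\<bar>q p\<bar> \<le> \<bar>B\<bar>" using b[of p] by (auto simp: space_restrict_space)
      then show "norm ((f p)\<^sup>2 * q p) \<le> norm (B * (f p)\<^sup>2)"
        by (simp add: abs_mult mult.commute mult_right_mono)
    qed
  qed measurable
  then show ?thesis using S by (simp add: set_integrable_restrict)
qed

text \<open>The Carleman inequality is passed from smooth functions to Sobolev functions term by term with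
  this lemma.  With \<open>a\<close> the error and \<open>b\<close> the limit,
  \<open>\<bar>(a + b)\<^sup>2 - b\<^sup>2\<bar> \<le> (1 + 1/e) a\<^sup>2 + e b\<^sup>2\<close> by Young's inequality; the first part vanishes in
  the limit for each fixed \<open>e\<close>, and the second is small with \<open>e\<close>.\<close>

lemma weighted_sqnorm_tendsto:
  assumes S: "S \<in> sets borel" and w: "\<And>n. L2_on S (w n)" and f: "L2_on S f"
    and lim: "L2_tendsto S w f" and q: "q \<in> borel_measurable borel"
    and b: "\<And>p. p \<in> S \<Longrightarrow> \<bar>q p\<bar> \<le> B"
  shows "(\<lambda>n. LINT p:S|lborel. (w n p)\<^sup>2 * q p) \<longlonglongrightarrow> (LINT p:S|lborel. (f p)\<^sup>2 * q p)"
proof -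
  define D where "D n = (LINT p:S|lborel. (w n p)\<^sup>2 * q p) - (LINT p:S|lborel. (f p)\<^sup>2 * q p)" for n
  define d where "d n = sqnorm S (\<lambda>p. w n p - f p)" for n
  have d0: "d \<longlonglongrightarrow> 0" using lim by (simp add: d_def[abs_def] L2_tendsto_sqnorm)
  have bnd: "\<bar>D n\<bar> \<le> \<bar>B\<bar> * ((1 + 1 / e) * d n + e * sqnorm S f)" if e: "e > 0" for e n
  proof -
    note wf = L2_on_diff[OF S w[of n] f]
    have i1: "set_integrable lborel S (\<lambda>p. (w n p)\<^sup>2 * q p - (f p)\<^sup>2 * q p)"
      using L2_on_weight_integrable[OF S w q b] L2_on_weight_integrable[OF S f q b]
      by (rule set_integral_diff(1))
    have i2: "set_integrable lborel S (\<lambda>p. (1 + 1 / e) * (w n p - f p)\<^sup>2 + e * (f p)\<^sup>2)"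
      using wf f by (intro set_integral_add) (auto simp: L2_on_def)
    have "\<bar>D n\<bar> = \<bar>LINT p:S|lborel. (w n p)\<^sup>2 * q p - (f p)\<^sup>2 * q p\<bar>"
      unfolding D_def using L2_on_weight_integrable[OF S w q b] L2_on_weight_integrable[OF S f q b]
      by (subst set_integral_diff) auto
    also have "\<dots> \<le> (LINT p:S|lborel. \<bar>(w n p)\<^sup>2 * q p - (f p)\<^sup>2 * q p\<bar>)"
      using set_integral_norm_bound[OF i1] by simp
    also have "\<dots> \<le> (LINT p:S|lborel. \<bar>B\<bar> * ((1 + 1 / e) * (w n p - f p)\<^sup>2 + e * (f p)\<^sup>2))"
    proof (rule set_integral_mono)
      show "set_integrable lborel S (\<lambda>p. \<bar>(w n p)\<^sup>2 * q p - (f p)\<^sup>2 * q p\<bar>)"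
        using i1 by (rule set_integrable_abs)
      show "set_integrable lborel S (\<lambda>p. \<bar>B\<bar> * ((1 + 1 / e) * (w n p - f p)\<^sup>2 + e * (f p)\<^sup>2))"
        using i2 by (rule set_integrable_mult_right)
      fix p assume p: "p \<in> S"
      let ?a = "w n p - f p" and ?b = "f p"
      have sq: "0 \<le> (\<bar>?a\<bar> - e * \<bar>?b\<bar>)\<^sup>2 / e" using e by simp
      have "(\<bar>?a\<bar> - e * \<bar>?b\<bar>)\<^sup>2 / e = ?a\<^sup>2 / e + e * ?b\<^sup>2 - 2 * (\<bar>?a\<bar> * \<bar>?b\<bar>)"
        using e by (simp add: power2_diff power_mult_distrib field_simps power2_eq_square)
      with sq have *: "2 * (\<bar>?a\<bar> * \<bar>?b\<bar>) \<le> ?a\<^sup>2 / e + e * ?b\<^sup>2" by linarith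
      have "(w n p)\<^sup>2 - (f p)\<^sup>2 = ?a\<^sup>2 + 2 * (?a * ?b)" by (simp add: power2_eq_square algebra_simps)
      then have "\<bar>(w n p)\<^sup>2 - (f p)\<^sup>2\<bar> \<le> \<bar>?a\<^sup>2\<bar> + \<bar>2 * (?a * ?b)\<bar>" by (metis abs_triangle_ineq)
      also have "\<dots> \<le> (1 + 1 / e) * ?a\<^sup>2 + e * ?b\<^sup>2"
        using * unfolding abs_mult by (simp add: distrib_right)
      finally have main: "\<bar>(w n p)\<^sup>2 - (f p)\<^sup>2\<bar> \<le> (1 + 1 / e) * ?a\<^sup>2 + e * ?b\<^sup>2" .
      have "\<bar>(w n p)\<^sup>2 * q p - (f p)\<^sup>2 * q p\<bar> = \<bar>q p\<bar> * \<bar>(w n p)\<^sup>2 - (f p)\<^sup>2\<bar>"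
        by (simp add: abs_mult[symmetric] algebra_simps)
      also have "\<dots> \<le> \<bar>B\<bar> * ((1 + 1 / e) * ?a\<^sup>2 + e * ?b\<^sup>2)"
        using b[OF p] main by (intro mult_mono) auto
      finally show "\<bar>(w n p)\<^sup>2 * q p - (f p)\<^sup>2 * q p\<bar> \<le> \<bar>B\<bar> * ((1 + 1 / e) * ?a\<^sup>2 + e * ?b\<^sup>2)" .
    qed
    also have "\<dots> = \<bar>B\<bar> * ((1 + 1 / e) * d n + e * sqnorm S f)"
      unfolding d_def sqnorm_def using wf f
      by (simp add: set_integral_add L2_on_def)
    finally show ?thesis .
  qed
  have "D \<longlonglongrightarrow> 0"
  proof (rule LIMSEQ_I)
    fix r :: real assume r: "r > 0"
    \<comment> \<open>Chosen so that the part of the bound that does not depend on \<open>n\<close> stays below \<open>r / 2\<close>.\<close>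
    define e where "e = r / (2 * (\<bar>B\<bar> * sqnorm S f + 1))"
    have pos: "\<bar>B\<bar> * sqnorm S f + 1 > 0" using sqnorm_nonneg[of S f] by (simp add: add_nonneg_pos)
    have e: "e > 0" using r pos by (simp add: e_def)
    have "e * (\<bar>B\<bar> * sqnorm S f + 1) = r / 2" using pos by (simp add: e_def field_simps)
    then have e2: "\<bar>B\<bar> * (e * sqnorm S f) < r / 2 + 0" using e by (simp add: algebra_simps)
    have "(\<lambda>n. \<bar>B\<bar> * ((1 + 1 / e) * d n)) \<longlonglongrightarrow> 0"
      by (intro tendsto_mult_right_zero d0)
    from LIMSEQ_D[OF this, of "r / 2"] r obtain N
      where N: "\<And>n. n \<ge> N \<Longrightarrow> \<bar>\<bar>B\<bar> * ((1 + 1 / e) * d n)\<bar> < r / 2" by auto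
    have "norm (D n - 0) < r" if "n \<ge> N" for n
      using bnd[OF e, of n] N[OF that] e2 abs_ge_self[of "\<bar>B\<bar> * ((1 + 1 / e) * d n)"]
      unfolding distrib_left[of "\<bar>B\<bar>"] real_norm_def by linarith
    then show "\<exists>N. \<forall>n\<ge>N. norm (D n - 0) < r" by blast
  qed
  then show ?thesis unfolding D_def by (rule LIM_zero_cancel)
qed

lemma continuous_set_integrable:
  fixes f :: "'a::euclidean_space \<Rightarrow> real"
  assumes f: "continuous_on UNIV f" and S: "S \<in> sets borel" "bounded S"
  shows "set_integrable lborel S f"
proof -
  have "set_integrable lborel (closure S) f"
    unfolding set_integrable_def using S f
    by (intro borel_integrable_compact) (auto simp: compact_closure intro: continuous_on_subset)
  then show ?thesis by (rule set_integrable_subset) (use S closure_subset in auto)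
qed

lemma continuous_L2_on:
  fixes f :: "'a::euclidean_space \<Rightarrow> real"
  assumes f: "continuous_on UNIV f" and S: "S \<in> sets borel" "bounded S"
  shows "L2_on S f"
proof -
  have "set_integrable lborel S (\<lambda>p. (f p)\<^sup>2)"
    by (intro continuous_set_integrable S continuous_intros f)
  moreover have "f \<in> borel_measurable borel" using f by (rule borel_measurable_continuous_onI)
  ultimately show ?thesis using S
    by (auto simp: L2_on_def set_borel_measurable_def)
qed

text \<open>Existence of traces rests on this.  On a bounded set an \<open>L2\<close> Cauchy sequence is Cauchy in
  \<open>L1\<close>, so a subsequence converges almost everywhere; Fatou's lemma along the subsequence then
  turns the Cauchy condition into \<open>L2\<close> convergence of the whole sequence.\<close>

lemma L2_complete:
  fixes S :: "'a::euclidean_space set"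
  assumes S: "S \<in> sets borel" "bounded S" and h: "\<And>n. L2_on S (h n)"
    and C: "\<And>e. e > 0 \<Longrightarrow> \<exists>N. \<forall>m\<ge>N. \<forall>n\<ge>N. sqnorm S (\<lambda>p. h m p - h n p) < e"
  shows "\<exists>g. L2_on S g \<and> L2_tendsto S h g"
proof -
  let ?M = "restrict_space lborel S"
  have one: "L2_on S (\<lambda>_. 1)" using S by (intro continuous_L2_on continuous_intros)
  have meas[measurable]: "h n \<in> borel_measurable ?M" for n using h S by (auto simp: L2_on_restrict)
  have int: "integrable ?M (h n)" for n
    using L2_on_mult_integrable[OF S(1) h one] by (simp add: set_integrable_restrict S)
  define V where "V = sqnorm S (\<lambda>_. 1)"
  have int2: "integrable ?M (\<lambda>p. (h m p - h n p)\<^sup>2)" for m n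
    using L2_on_diff[OF S(1) h h] by (simp add: L2_on_restrict S)
  have eqn: "sqnorm S f = (LINT p|?M. (f p)\<^sup>2)" for f
    using S by (simp add: sqnorm_def set_lebesgue_integral_def integral_restrict_space)
  have L1: "(LINT p|?M. norm (h m p - h n p)) \<le> sqnorm S (\<lambda>p. h m p - h n p) / e + e * V"
    if e: "e > 0" for e m n
  proof -
    have c: "integrable ?M (\<lambda>_. 1::real)"
      using one by (simp add: L2_on_restrict S)
    have V: "V = (LINT p|?M. 1)" by (simp add: V_def eqn)
    have "(LINT p|?M. norm (h m p - h n p)) \<le> (LINT p|?M. (h m p - h n p)\<^sup>2 / e + e * 1)"
    proof (rule integral_mono)
      show "integrable ?M (\<lambda>p. norm (h m p - h n p))" using int by auto
      show "integrable ?M (\<lambda>p. (h m p - h n p)\<^sup>2 / e + e * 1)"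
        by (intro Bochner_Integration.integrable_add integrable_divide integrable_mult_right int2 c)
      fix p
      let ?a = "\<bar>h m p - h n p\<bar>"
      have "0 \<le> (?a - e)\<^sup>2 + e * ?a" using e by (simp add: add_nonneg_nonneg)
      then have "e * ?a \<le> ?a\<^sup>2 + e * e"
        by (simp add: power2_eq_square algebra_simps)
      then show "norm (h m p - h n p) \<le> (h m p - h n p)\<^sup>2 / e + e * 1"
        using e by (simp add: field_simps)
    qed
    also have "\<dots> = sqnorm S (\<lambda>p. h m p - h n p) / e + e * V"
      using int2 integrable_mult_right[OF c, of e] by (subst Bochner_Integration.integral_add) (auto simp: eqn V)
    finally show ?thesis .
  qed
  have V0: "V \<ge> 0" by (simp add: V_def sqnorm_nonneg)
  have "\<exists>N. \<forall>i\<ge>N. \<forall>j\<ge>N. LINT x|?M. norm (h i x - h j x) < r" if r: "r > 0" for r :: real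
  proof -
    define e where "e = r / (2 * (V + 1))"
    have e: "e > 0" using r V0 by (simp add: e_def)
    have ev: "e * V < r / 2 + 0"
    proof -
      have "e * (V + 1) = r / 2" using V0 by (simp add: e_def field_simps)
      then show ?thesis using e by (simp add: algebra_simps)
    qed
    obtain N where N: "\<And>m n. m \<ge> N \<Longrightarrow> n \<ge> N \<Longrightarrow> sqnorm S (\<lambda>p. h m p - h n p) < e * (r / 2)"
      using C[of "e * (r / 2)"] e r by auto
    have "(LINT x|?M. norm (h i x - h j x)) < r" if "i \<ge> N" "j \<ge> N" for i j
    proof -
      have "sqnorm S (\<lambda>p. h i p - h j p) / e < r / 2"
        using N[OF that] e by (simp add: field_simps)
      then show ?thesis using L1[OF e, of i j] ev by linarith
    qed
    then show ?thesis by blast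
  qed
  from cauchy_L1_AE_cauchy_subseq[OF int this] obtain r
    where r: "strict_mono r" and ae: "AE x in ?M. Cauchy (\<lambda>i. h (r i) x)" by blast
  define g where "g x = (if Cauchy (\<lambda>i. h (r i) x) then lim (\<lambda>i. h (r i) x) else 0)" for x
  have gm[measurable]: "g \<in> borel_measurable ?M" unfolding g_def by measurable
  have conv: "AE x in ?M. (\<lambda>i. h (r i) x) \<longlonglongrightarrow> g x"
    using ae by eventually_elim (auto simp: g_def Cauchy_convergent_iff convergent_LIMSEQ_iff)
  \<comment> \<open>A uniform bound on the distances to the later members passes to the pointwise limit.\<close>
  have fatou: "integrable ?M (\<lambda>x. (h m x - g x)\<^sup>2) \<and> sqnorm S (\<lambda>x. h m x - g x) \<le> e"
    if e: "e > 0" and N: "\<And>n. n \<ge> N \<Longrightarrow> sqnorm S (\<lambda>p. h m p - h n p) \<le> e" for m N e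
  proof -
    have nn: "(\<integral>\<^sup>+ x. ennreal ((h m x - h n x)\<^sup>2) \<partial>?M) = ennreal (sqnorm S (\<lambda>p. h m p - h n p))" for n
      unfolding eqn by (rule nn_integral_eq_integral[OF int2]) simp
    have "(\<integral>\<^sup>+ x. ennreal ((h m x - g x)\<^sup>2) \<partial>?M)
        = (\<integral>\<^sup>+ x. liminf (\<lambda>i. ennreal ((h m x - h (r i) x)\<^sup>2)) \<partial>?M)"
    proof (rule nn_integral_cong_AE)
      show "AE x in ?M. ennreal ((h m x - g x)\<^sup>2) = liminf (\<lambda>i. ennreal ((h m x - h (r i) x)\<^sup>2))"
        using conv
      proof eventually_elim
        fix x assume "(\<lambda>i. h (r i) x) \<longlonglongrightarrow> g x"
        then have "(\<lambda>i. ennreal ((h m x - h (r i) x)\<^sup>2)) \<longlonglongrightarrow> ennreal ((h m x - g x)\<^sup>2)"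
          by (intro tendsto_intros)
        then show "ennreal ((h m x - g x)\<^sup>2) = liminf (\<lambda>i. ennreal ((h m x - h (r i) x)\<^sup>2))"
          by (metis lim_imp_Liminf trivial_limit_sequentially)
      qed
    qed
    also have "\<dots> \<le> liminf (\<lambda>i. \<integral>\<^sup>+ x. ennreal ((h m x - h (r i) x)\<^sup>2) \<partial>?M)"
      by (rule nn_integral_liminf) measurable
    also have "\<dots> \<le> limsup (\<lambda>i. \<integral>\<^sup>+ x. ennreal ((h m x - h (r i) x)\<^sup>2) \<partial>?M)"
      by (rule Liminf_le_Limsup) simp
    also have "\<dots> \<le> ennreal e"
    proof (rule Limsup_bounded)
      show "\<forall>\<^sub>F i in sequentially. (\<integral>\<^sup>+ x. ennreal ((h m x - h (r i) x)\<^sup>2) \<partial>?M) \<le> ennreal e"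
        using eventually_ge_at_top[of N]
      proof eventually_elim
        fix i assume "i \<ge> N"
        then have "r i \<ge> N" using seq_suble[OF r, of i] by linarith
        then show "(\<integral>\<^sup>+ x. ennreal ((h m x - h (r i) x)\<^sup>2) \<partial>?M) \<le> ennreal e"
          using N[of "r i"] by (simp add: nn ennreal_leI)
      qed
    qed
    finally have le: "(\<integral>\<^sup>+ x. ennreal ((h m x - g x)\<^sup>2) \<partial>?M) \<le> ennreal e" .
    have I: "integrable ?M (\<lambda>x. (h m x - g x)\<^sup>2)"
    proof (rule integrableI_bounded)
      show "(\<integral>\<^sup>+ x. ennreal (norm ((h m x - g x)\<^sup>2)) \<partial>?M) < \<infinity>"
        using le by (simp add: le_less_trans[OF _ ennreal_less_top])
    qed measurable
    moreover have "(LINT x|?M. (h m x - g x)\<^sup>2) \<le> e"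
    proof -
      have "ennreal (LINT x|?M. (h m x - g x)\<^sup>2) \<le> ennreal e"
        using nn_integral_eq_integral[OF I] le by simp
      then show ?thesis using e by (simp add: ennreal_le_iff)
    qed
    ultimately show ?thesis by (simp add: eqn)
  qed
  have ev: "\<exists>N. \<forall>m\<ge>N. integrable ?M (\<lambda>x. (h m x - g x)\<^sup>2) \<and> sqnorm S (\<lambda>x. h m x - g x) \<le> e"
    if "e > 0" for e
  proof -
    obtain N where "\<forall>m\<ge>N. \<forall>n\<ge>N. sqnorm S (\<lambda>p. h m p - h n p) < e" using C[OF \<open>e > 0\<close>] by blast
    then have "integrable ?M (\<lambda>x. (h m x - g x)\<^sup>2) \<and> sqnorm S (\<lambda>x. h m x - g x) \<le> e"
      if "m \<ge> N" for m
      using that by (intro fatou[OF \<open>e > 0\<close>, of N]) (auto intro: less_imp_le)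
    then show ?thesis by blast
  qed
  obtain m where "integrable ?M (\<lambda>x. (h m x - g x)\<^sup>2)" using ev[of 1] by auto
  then have "L2_on S (\<lambda>x. h m x - g x)" by (simp add: L2_on_restrict S)
  from L2_on_diff[OF S(1) h this, of m] have g: "L2_on S g" by simp
  have "L2_tendsto S h g" unfolding L2_tendsto_sqnorm
  proof (rule LIMSEQ_I)
    fix e :: real assume "e > 0"
    then show "\<exists>N. \<forall>n\<ge>N. norm (sqnorm S (\<lambda>p. h n p - g p) - 0) < e"
      using ev[of "e / 2"] by (fastforce simp: sqnorm_nonneg)
  qed
  with g show ?thesis by blast
qed

section \<open>Smooth functions and primitives\<close>

lemma smooth_C_k: "smooth f \<Longrightarrow> C_k k f"
  by (simp add: smooth_def)

lemma smooth_continuous: "smooth f \<Longrightarrow> continuous_on UNIV f"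
  using smooth_C_k[of f 0] by simp

lemma smooth_pd_x: "smooth f \<Longrightarrow> smooth (pd_x f)"
  unfolding smooth_def by (metis C_k.simps(2))

lemma smooth_pd_t: "smooth f \<Longrightarrow> smooth (pd_t f)"
  unfolding smooth_def by (metis C_k.simps(2))

lemma smooth_DERIV_x:
  assumes "smooth f"
  shows "((\<lambda>y. f (y, t)) has_real_derivative pd_x f (x, t)) (at x)"
  using smooth_C_k[OF assms, of "Suc 0"] by (simp add: pd_x_def DERIV_deriv_iff_real_differentiable)

lemma smooth_DERIV_t:
  assumes "smooth f"
  shows "((\<lambda>s. f (x, s)) has_real_derivative pd_t f (x, t)) (at t)"
  using smooth_C_k[OF assms, of "Suc 0"] by (simp add: pd_t_def DERIV_deriv_iff_real_differentiable)

lemma DERIV_imp_differentiable: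
  fixes f :: "real \<Rightarrow> real"
  shows "(f has_real_derivative D) (at x) \<Longrightarrow> f differentiable (at x)"
  by (auto simp: real_differentiable_def)

text \<open>A coinduction principle: the orders of differentiability are established simultaneously for the whole
  family \<open>P\<close>, so that no formula for the higher derivatives of a particular function is ever written.\<close>

lemma smooth_coinduct:
  assumes D: "\<And>f. P f \<Longrightarrow> continuous_on UNIV f \<and>
      (\<forall>x t. (\<lambda>y. f (y, t)) differentiable (at x) \<and> (\<lambda>s. f (x, s)) differentiable (at t))"
    and x: "\<And>f. P f \<Longrightarrow> P (pd_x f) \<or> smooth (pd_x f)" and t: "\<And>f. P f \<Longrightarrow> P (pd_t f) \<or> smooth (pd_t f)"
    and f: "P f"
  shows "smooth f"
proof -
  have "C_k k f" if "P f" for k f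
    using that
  proof (induction k arbitrary: f)
    case 0
    then show ?case using D by simp
  next
    case (Suc k)
    have "C_k k (pd_x f)" using x[OF Suc.prems] Suc.IH smooth_C_k by blast
    moreover have "C_k k (pd_t f)" using t[OF Suc.prems] Suc.IH smooth_C_k by blast
    ultimately show ?case using D[OF Suc.prems] by simp
  qed
  with f show ?thesis by (simp add: smooth_def)
qed

lemma pd_x_eq:
  assumes "\<And>x t. ((\<lambda>y. f (y, t)) has_real_derivative g (x, t)) (at x)"
  shows "pd_x f = g"
  by (rule ext) (simp add: pd_x_def DERIV_imp_deriv[OF assms])

lemma pd_t_eq:
  assumes "\<And>x t. ((\<lambda>s. f (x, s)) has_real_derivative g (x, t)) (at t)"
  shows "pd_t f = g"
  by (rule ext) (simp add: pd_t_def DERIV_imp_deriv[OF assms])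

lemma pd_x_lincomb:
  assumes "smooth f" "smooth g"
  shows "pd_x (\<lambda>p. f p + c * g p) = (\<lambda>p. pd_x f p + c * pd_x g p)"
  by (rule pd_x_eq) (intro DERIV_add DERIV_cmult smooth_DERIV_x assms)

lemma pd_t_lincomb:
  assumes "smooth f" "smooth g"
  shows "pd_t (\<lambda>p. f p + c * g p) = (\<lambda>p. pd_t f p + c * pd_t g p)"
  by (rule pd_t_eq) (intro DERIV_add DERIV_cmult smooth_DERIV_t assms)

lemma smooth_lincomb:
  assumes "smooth f" "smooth g"
  shows "smooth (\<lambda>p. f p + c * g p)"
proof (rule smooth_coinduct[where P = "\<lambda>h. \<exists>f g. smooth f \<and> smooth g \<and> h = (\<lambda>p. f p + c * g p)"])
  fix h assume "\<exists>f g. smooth f \<and> smooth g \<and> h = (\<lambda>p. f p + c * g p)"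
  then obtain f g where fg: "smooth f" "smooth g" and h: "h = (\<lambda>p. f p + c * g p)" by blast
  show "continuous_on UNIV h \<and>
      (\<forall>x t. (\<lambda>y. h (y, t)) differentiable (at x) \<and> (\<lambda>s. h (x, s)) differentiable (at t))"
    unfolding h
    by (intro conjI allI continuous_intros smooth_continuous fg
        DERIV_imp_differentiable[OF DERIV_add[OF smooth_DERIV_x[OF fg(1)] DERIV_cmult[OF smooth_DERIV_x[OF fg(2)]]]]
        DERIV_imp_differentiable[OF DERIV_add[OF smooth_DERIV_t[OF fg(1)] DERIV_cmult[OF smooth_DERIV_t[OF fg(2)]]]])
  show "(\<exists>f g. smooth f \<and> smooth g \<and> pd_x h = (\<lambda>p. f p + c * g p)) \<or> smooth (pd_x h)"
    unfolding h pd_x_lincomb[OF fg] using fg smooth_pd_x by blast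
  show "(\<exists>f g. smooth f \<and> smooth g \<and> pd_t h = (\<lambda>p. f p + c * g p)) \<or> smooth (pd_t h)"
    unfolding h pd_t_lincomb[OF fg] using fg smooth_pd_t by blast
qed (use assms in blast)

lemma pd_x_diff: "smooth f \<Longrightarrow> smooth g \<Longrightarrow> pd_x (\<lambda>p. f p - g p) = (\<lambda>p. pd_x f p - pd_x g p)"
  using pd_x_lincomb[of f g "-1"] by simp

lemma pd_t_diff: "smooth f \<Longrightarrow> smooth g \<Longrightarrow> pd_t (\<lambda>p. f p - g p) = (\<lambda>p. pd_t f p - pd_t g p)"
  using pd_t_lincomb[of f g "-1"] by simp

lemma smooth_diff: "smooth f \<Longrightarrow> smooth g \<Longrightarrow> smooth (\<lambda>p. f p - g p)"
  using smooth_lincomb[of f g "-1"] by simp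

text \<open>The primitive \<open>(x, t) \<mapsto> \<integral>\<^sub>0\<^sup>x v (y, t) dy\<close>, rescaled to a fixed interval: this form is
  meaningful for every real \<open>x\<close>, and it can be differentiated under the integral sign in both
  variables.\<close>

definition x_primitive :: "(real \<times> real \<Rightarrow> real) \<Rightarrow> real \<times> real \<Rightarrow> real" where
  "x_primitive v p = integral (cbox 0 1) (\<lambda>s. fst p * v (s * fst p, snd p))"

lemma continuous_comp_UNIV:
  "continuous_on UNIV f \<Longrightarrow> continuous_on S g \<Longrightarrow> continuous_on S (\<lambda>x. f (g x))"
  by (rule continuous_on_compose2[of UNIV f]) auto

lemma continuous_x_primitive:
  assumes v: "smooth v"
  shows "continuous_on UNIV (x_primitive v)"
  unfolding x_primitive_def[abs_def]
  by (rule integral_continuous_on_param)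
     (auto simp: case_prod_unfold intro!: continuous_intros continuous_comp_UNIV[OF smooth_continuous[OF v]])

lemma x_primitive_DERIV_t:
  assumes v: "smooth v"
  shows "((\<lambda>s. x_primitive v (x, s)) has_real_derivative x_primitive (pd_t v) (x, t)) (at t)"
  unfolding x_primitive_def fst_conv snd_conv
proof (rule leibniz_rule_field_derivative)
  show "((\<lambda>s. x * v (r * x, s)) has_real_derivative x * pd_t v (r * x, s)) (at s within UNIV)" for s r
    using DERIV_cmult[OF smooth_DERIV_t[OF v, of "r * x" s], of x] by simp
  show "(\<lambda>r. x * v (r * x, s)) integrable_on cbox 0 1" for s
    by (intro integrable_continuous continuous_intros continuous_comp_UNIV[OF smooth_continuous[OF v]])
  show "continuous_on (UNIV \<times> cbox 0 1) (\<lambda>(s, r). x * pd_t v (r * x, s))"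
    by (auto simp: case_prod_unfold intro!: continuous_intros
        continuous_comp_UNIV[OF smooth_continuous[OF smooth_pd_t[OF v]]])
qed auto

text \<open>Differentiation under the integral sign produces the integrand \<open>v (s x, t) + s x v\<^sub>x (s x, t)\<close>, which
  is the derivative of \<open>s v (s x, t)\<close> with respect to \<open>s\<close>.\<close>

lemma x_primitive_DERIV_x:
  assumes v: "smooth v"
  shows "((\<lambda>y. x_primitive v (y, t)) has_real_derivative v (x, t)) (at x)"
proof -
  let ?g = "\<lambda>y s. v (s * y, t) + s * y * pd_x v (s * y, t)"
  have "((\<lambda>y. integral (cbox 0 1) (\<lambda>s. y * v (s * y, t))) has_real_derivative
      integral (cbox 0 1) (?g x)) (at x)"
  proof (rule leibniz_rule_field_derivative)
    show "((\<lambda>y. y * v (s * y, t)) has_real_derivative ?g y s) (at y within UNIV)" for y s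
      by (rule derivative_eq_intros DERIV_chain'[OF _ smooth_DERIV_x[OF v]] refl)+ simp
    show "(\<lambda>s. y * v (s * y, t)) integrable_on cbox 0 1" for y
      by (intro integrable_continuous continuous_intros continuous_comp_UNIV[OF smooth_continuous[OF v]])
    show "continuous_on (UNIV \<times> cbox 0 1) (\<lambda>(y, s). ?g y s)"
      by (auto simp: case_prod_unfold intro!: continuous_intros
          continuous_comp_UNIV[OF smooth_continuous[OF v]]
          continuous_comp_UNIV[OF smooth_continuous[OF smooth_pd_x[OF v]]])
  qed auto
  moreover have "(?g x has_integral 1 * v (1 * x, t) - 0 * v (0 * x, t)) {0..1}"
  proof (rule fundamental_theorem_of_calculus)
    fix s :: real
    have "((\<lambda>s. s * v (s * x, t)) has_real_derivative ?g x s) (at s)"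
      by (rule derivative_eq_intros DERIV_chain'[OF _ smooth_DERIV_x[OF v]] refl)+ simp
    then show "((\<lambda>s. s * v (s * x, t)) has_vector_derivative ?g x s) (at s within {0..1})"
      by (simp add: has_real_derivative_iff_has_vector_derivative has_vector_derivative_at_within)
  qed simp
  then have "integral (cbox 0 1) (?g x) = v (x, t)" by (simp add: integral_unique)
  ultimately show ?thesis by (simp add: x_primitive_def)
qed

lemma pd_x_x_primitive: "smooth v \<Longrightarrow> pd_x (x_primitive v) = v"
  by (rule pd_x_eq) (rule x_primitive_DERIV_x)

lemma pd_t_x_primitive: "smooth v \<Longrightarrow> pd_t (x_primitive v) = x_primitive (pd_t v)"
  by (rule pd_t_eq) (rule x_primitive_DERIV_t)

lemma x_primitive_left: "x_primitive v (0, t) = 0"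
  by (simp add: x_primitive_def)

text \<open>The family of all primitives is closed under \<open>pd_t\<close>, and \<open>pd_x\<close> leads back to smooth
  functions.\<close>

lemma smooth_x_primitive:
  assumes "smooth v"
  shows "smooth (x_primitive v)"
proof (rule smooth_coinduct[where P = "\<lambda>h. \<exists>v. smooth v \<and> h = x_primitive v"])
  fix h assume "\<exists>v. smooth v \<and> h = x_primitive v"
  then obtain v where v: "smooth v" and h: "h = x_primitive v" by blast
  show "continuous_on UNIV h \<and>
      (\<forall>x t. (\<lambda>y. h (y, t)) differentiable (at x) \<and> (\<lambda>s. h (x, s)) differentiable (at t))"
    unfolding h
    by (intro conjI allI continuous_x_primitive v DERIV_imp_differentiable[OF x_primitive_DERIV_x[OF v]]
        DERIV_imp_differentiable[OF x_primitive_DERIV_t[OF v]])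
  show "(\<exists>v. smooth v \<and> pd_x h = x_primitive v) \<or> smooth (pd_x h)"
    unfolding h pd_x_x_primitive[OF v] using v by blast
  show "(\<exists>v. smooth v \<and> pd_t h = x_primitive v) \<or> smooth (pd_t h)"
    unfolding h pd_t_x_primitive[OF v] using smooth_pd_t[OF v] by blast
qed (use assms in blast)

section \<open>Integration over the rectangle\<close>

lemma rect_borel: "rect T \<in> sets borel"
  unfolding rect_def by (intro borel_open open_Times) auto

lemma rect_bounded: "bounded (rect T)"
  unfolding rect_def by (intro bounded_Times) auto

lemma rect_Fubini:
  fixes f :: "real \<times> real \<Rightarrow> real"
  assumes f: "continuous_on UNIV f"
  shows "(LINT p:rect T|lborel. f p) = (LINT x:{0<..<1}|lborel. LINT t:{0<..<T}|lborel. f (x, t))"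
    and "(LINT p:rect T|lborel. f p) = (LINT t:{0<..<T}|lborel. LINT x:{0<..<1}|lborel. f (x, t))"
proof -
  let ?F = "\<lambda>x t. indicator {0<..<1::real} x *\<^sub>R indicator {0<..<T} t *\<^sub>R f (x, t)"
  have eq: "(\<lambda>p. indicator (rect T) p *\<^sub>R f p) = case_prod ?F"
    by (auto simp: rect_def indicator_def)
  have int: "integrable (lborel \<Otimes>\<^sub>M lborel) (case_prod ?F)"
    using continuous_set_integrable[OF f rect_borel rect_bounded, of T]
    by (simp only: set_integrable_def eq lborel_prod)
  have "(LINT p:rect T|lborel. f p) = integral\<^sup>L (lborel \<Otimes>\<^sub>M lborel) (case_prod ?F)"
    by (simp only: set_lebesgue_integral_def eq lborel_prod)
  with lborel_pair.integral_fst[OF int] lborel_pair.integral_snd[OF int]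
  have "(LINT p:rect T|lborel. f p) = (LBINT x. LBINT t. ?F x t)"
    and *: "(LINT p:rect T|lborel. f p) = (LBINT t. LBINT x. ?F x t)" by simp_all
  then show "(LINT p:rect T|lborel. f p) = (LINT x:{0<..<1}|lborel. LINT t:{0<..<T}|lborel. f (x, t))"
    by (simp add: set_lebesgue_integral_def)
  have "?F x t = indicator {0<..<T} t *\<^sub>R indicator {0<..<1} x *\<^sub>R f (x, t)" for x t by simp
  with * show "(LINT p:rect T|lborel. f p) = (LINT t:{0<..<T}|lborel. LINT x:{0<..<1}|lborel. f (x, t))"
    by (simp only: set_lebesgue_integral_def integral_scaleR_right)
qed

lemma integral_derivative_Ioo:
  fixes f F :: "real \<Rightarrow> real"
  assumes "a \<le> b" and f: "continuous_on UNIV f" and F: "\<And>x. (F has_real_derivative f x) (at x)"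
  shows "(LINT x:{a<..<b}|lborel. f x) = F b - F a"
proof -
  have "(LBINT x=a..b. f x) = F b - F a"
    using F by (intro interval_integral_FTC_finite continuous_on_subset[OF f])
      (auto simp: has_real_derivative_iff_has_vector_derivative[symmetric]
        intro: has_field_derivative_at_within)
  then show ?thesis using \<open>a \<le> b\<close> by (simp add: interval_integral_Ioo)
qed

lemma rect_integral_x_derivative:
  fixes f F :: "real \<times> real \<Rightarrow> real"
  assumes "continuous_on UNIV f" and "\<And>x t. ((\<lambda>y. F (y, t)) has_real_derivative f (x, t)) (at x)"
  shows "(LINT p:rect T|lborel. f p) = (LINT t:{0<..<T}|lborel. F (1, t) - F (0, t))"
proof -
  have "(LINT x:{0<..<1}|lborel. f (x, t)) = F (1, t) - F (0, t)" for t
    using assms(2) by (intro integral_derivative_Ioo continuous_comp_UNIV[OF assms(1)] continuous_intros) auto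
  then show ?thesis by (simp add: rect_Fubini(2)[OF assms(1)])
qed

lemma rect_integral_t_derivative:
  fixes f F :: "real \<times> real \<Rightarrow> real"
  assumes "0 \<le> T" and "continuous_on UNIV f"
    and "\<And>x t. ((\<lambda>s. F (x, s)) has_real_derivative f (x, t)) (at t)"
  shows "(LINT p:rect T|lborel. f p) = (LINT x:{0<..<1}|lborel. F (x, T) - F (x, 0))"
proof -
  have "(LINT t:{0<..<T}|lborel. f (x, t)) = F (x, T) - F (x, 0)" for x
    using assms by (intro integral_derivative_Ioo continuous_comp_UNIV[OF assms(2)] continuous_intros) auto
  then show ?thesis by (simp add: rect_Fubini(1)[OF assms(2)])
qed

section \<open>Weighted estimates for smooth functions\<close>

lemma continuous_carleman_weight: "continuous_on S (carleman_weight \<alpha> lam)"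
  unfolding carleman_weight_def[abs_def] by (intro continuous_intros)

lemma carleman_weight_pos: "0 < carleman_weight \<alpha> lam p"
  by (simp add: carleman_weight_def)

lemma carleman_weight_le_1:
  assumes "0 \<le> \<alpha>" "0 \<le> lam" "p \<in> rect T"
  shows "carleman_weight \<alpha> lam p \<le> 1"
  using assms by (auto simp: carleman_weight_def rect_def intro!: mult_nonneg_nonneg add_nonneg_nonneg)

text \<open>The gain comes from the decay of the weight along the transport direction.  Write \<open>D = \<partial>\<^sub>x - \<beta> \<partial>\<^sub>t\<close> and \<open>\<phi>\<close> for the weight, so that
  \<open>D \<phi> = - 2 lam \<kappa> \<phi>\<close>.  Expanding the square \<open>(D v - lam \<kappa> v)\<^sup>2 \<phi> \<ge> 0\<close> gives
  \<open>(D v)\<^sup>2 \<phi> \<ge> (lam \<kappa>)\<^sup>2 v\<^sup>2 \<phi> + lam \<kappa> D (v\<^sup>2 \<phi>)\<close>, and the last term integrates to the sides of the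
  rectangle.  The sides \<open>x = 1\<close> and \<open>t = 0\<close> contribute with the good sign; \<open>x = 0\<close> and \<open>t = T\<close>
  are moved to the right.\<close>

lemma transport_estimate:
  assumes v: "smooth v" and pos: "0 \<le> \<alpha>" "0 \<le> \<beta>" "0 \<le> lam" "0 \<le> T" and k: "\<kappa> = 1 - \<beta> * \<alpha>" "0 \<le> \<kappa>"
  shows "(lam * \<kappa>)\<^sup>2 * (LINT p:rect T|lborel. (v p)\<^sup>2 * carleman_weight \<alpha> lam p)
      + \<beta> * lam * \<kappa> * (LINT x:{0<..<1}|lborel. (v (x, 0))\<^sup>2 * exp (- 2 * lam * x))
    \<le> (LINT p:rect T|lborel. (pd_x v p - \<beta> * pd_t v p)\<^sup>2 * carleman_weight \<alpha> lam p)
      + lam * \<kappa> * sqnorm {0<..<T} (\<lambda>t. v (0, t))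
      + \<beta> * lam * \<kappa> * exp (- 2 * lam * \<alpha> * T) * sqnorm {0<..<1} (\<lambda>x. v (x, T))"
proof -
  let ?w = "carleman_weight \<alpha> lam"
  \<comment> \<open>\<open>Gx\<close> and \<open>Gt\<close> are the two partial derivatives of the flux density \<open>F\<close>.\<close>
  define F where "F p = (v p)\<^sup>2 * ?w p" for p
  define Gx where "Gx p = (2 * v p * pd_x v p - 2 * lam * (v p)\<^sup>2) * ?w p" for p
  define Gt where "Gt p = (2 * v p * pd_t v p - 2 * lam * \<alpha> * (v p)\<^sup>2) * ?w p" for p
  define Q where "Q p = (pd_x v p - \<beta> * pd_t v p)\<^sup>2 * ?w p" for p
  note cont = smooth_continuous[OF v] smooth_continuous[OF smooth_pd_x[OF v]]
    smooth_continuous[OF smooth_pd_t[OF v]]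
  have cF: "continuous_on UNIV F" and cGx: "continuous_on UNIV Gx" and cGt: "continuous_on UNIV Gt"
    and cQ: "continuous_on UNIV Q"
    unfolding F_def[abs_def] Gx_def[abs_def] Gt_def[abs_def] Q_def[abs_def]
    by (intro continuous_intros cont continuous_carleman_weight)+
  have DFx: "((\<lambda>y. F (y, t)) has_real_derivative Gx (x, t)) (at x)" for x t
    unfolding F_def Gx_def carleman_weight_def fst_conv snd_conv
    by (rule derivative_eq_intros smooth_DERIV_x[OF v] refl)+ (simp add: algebra_simps power2_eq_square)
  have DFt: "((\<lambda>s. F (x, s)) has_real_derivative Gt (x, t)) (at t)" for x t
    unfolding F_def Gt_def carleman_weight_def fst_conv snd_conv
    by (rule derivative_eq_intros smooth_DERIV_t[OF v] refl)+ (simp add: algebra_simps power2_eq_square)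
  note int = continuous_set_integrable[OF _ rect_borel rect_bounded]
  have i1: "continuous_on UNIV (\<lambda>x. f (x, c))" and i2: "continuous_on UNIV (\<lambda>x. f (c, x))"
    if "continuous_on UNIV f" for f :: "real \<times> real \<Rightarrow> real" and c
    by (rule continuous_comp_UNIV[OF that] continuous_intros)+
  have I: "set_integrable lborel {a<..<b} h" if "continuous_on UNIV h" for a b :: real and h :: "real \<Rightarrow> real"
    using that by (rule continuous_set_integrable) auto
  have le: "(lam * \<kappa>)\<^sup>2 * F p + lam * \<kappa> * (Gx p - \<beta> * Gt p) \<le> Q p" for p
  proof -
    let ?D = "pd_x v p - \<beta> * pd_t v p"
    have "Q p - ((lam * \<kappa>)\<^sup>2 * F p + lam * \<kappa> * (Gx p - \<beta> * Gt p)) = (?D - lam * \<kappa> * v p)\<^sup>2 * ?w p"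
      unfolding Q_def F_def Gx_def Gt_def k by (simp add: power2_eq_square algebra_simps)
    also have "\<dots> \<ge> 0" by (simp add: less_imp_le[OF carleman_weight_pos])
    finally show ?thesis by simp
  qed
  have split: "(LINT p:rect T|lborel. (lam * \<kappa>)\<^sup>2 * F p + lam * \<kappa> * (Gx p - \<beta> * Gt p))
      = (lam * \<kappa>)\<^sup>2 * (LINT p:rect T|lborel. F p)
        + lam * \<kappa> * ((LINT p:rect T|lborel. Gx p) - \<beta> * (LINT p:rect T|lborel. Gt p))"
    using int[OF cF, of T] int[OF cGx, of T] int[OF cGt, of T]
    by (simp add: set_integral_add set_integral_diff)
  have "(LINT p:rect T|lborel. (lam * \<kappa>)\<^sup>2 * F p + lam * \<kappa> * (Gx p - \<beta> * Gt p))
      \<le> (LINT p:rect T|lborel. Q p)"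
    by (rule set_integral_mono[OF int int le]) (intro continuous_intros cF cGx cGt cQ)+
  moreover have "(LINT p:rect T|lborel. Gx p) \<ge> - sqnorm {0<..<T} (\<lambda>t. v (0, t))"
  proof -
    have "- sqnorm {0<..<T} (\<lambda>t. v (0, t)) = (LINT t:{0<..<T}|lborel. - (v (0, t))\<^sup>2)"
      by (simp add: sqnorm_def set_lebesgue_integral_def)
    also have "\<dots> \<le> (LINT t:{0<..<T}|lborel. F (1, t) - F (0, t))"
    proof (rule set_integral_mono)
      show "set_integrable lborel {0<..<T} (\<lambda>t. - (v (0, t))\<^sup>2)"
        by (intro I continuous_intros i2 cont)
      show "set_integrable lborel {0<..<T} (\<lambda>t. F (1, t) - F (0, t))"
        by (intro I continuous_intros i2 cF)
      fix t assume "t \<in> {0<..<T}"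
      then have "?w (0, t) \<le> 1" using pos by (auto simp: carleman_weight_def)
      then have "F (0, t) \<le> (v (0, t))\<^sup>2" unfolding F_def by (intro mult_left_le) auto
      moreover have "0 \<le> F (1, t)" unfolding F_def by (simp add: less_imp_le[OF carleman_weight_pos])
      ultimately show "- (v (0, t))\<^sup>2 \<le> F (1, t) - F (0, t)" by linarith
    qed
    finally show ?thesis by (simp add: rect_integral_x_derivative[OF cGx DFx])
  qed
  moreover have "(LINT p:rect T|lborel. Gt p) \<le> exp (- 2 * lam * \<alpha> * T) * sqnorm {0<..<1} (\<lambda>x. v (x, T))
      - (LINT x:{0<..<1}|lborel. (v (x, 0))\<^sup>2 * exp (- 2 * lam * x))"
  proof -
    have "(LINT p:rect T|lborel. Gt p) = (LINT x:{0<..<1}|lborel. F (x, T) - F (x, 0))"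
      by (rule rect_integral_t_derivative[OF pos(4) cGt DFt])
    also have "\<dots> \<le> (LINT x:{0<..<1}|lborel. exp (- 2 * lam * \<alpha> * T) * (v (x, T))\<^sup>2
        - (v (x, 0))\<^sup>2 * exp (- 2 * lam * x))"
    proof (rule set_integral_mono)
      show "set_integrable lborel {0<..<1} (\<lambda>x. F (x, T) - F (x, 0))"
        by (intro I continuous_intros i1 cF)
      show "set_integrable lborel {0<..<1} (\<lambda>x. exp (- 2 * lam * \<alpha> * T) * (v (x, T))\<^sup>2
        - (v (x, 0))\<^sup>2 * exp (- 2 * lam * x))"
        by (intro I continuous_intros i1 cont)
      fix x :: real assume "x \<in> {0<..<1}"
      then have "?w (x, T) \<le> exp (- 2 * lam * \<alpha> * T)"
        using pos by (auto simp: carleman_weight_def algebra_simps)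
      then have "F (x, T) \<le> exp (- 2 * lam * \<alpha> * T) * (v (x, T))\<^sup>2"
        unfolding F_def by (subst mult.commute) (intro mult_right_mono, auto)
      then show "F (x, T) - F (x, 0) \<le> exp (- 2 * lam * \<alpha> * T) * (v (x, T))\<^sup>2
        - (v (x, 0))\<^sup>2 * exp (- 2 * lam * x)"
        by (simp add: F_def carleman_weight_def)
    qed
    also have "\<dots> = exp (- 2 * lam * \<alpha> * T) * sqnorm {0<..<1} (\<lambda>x. v (x, T))
      - (LINT x:{0<..<1}|lborel. (v (x, 0))\<^sup>2 * exp (- 2 * lam * x))"
      unfolding sqnorm_def
      by (subst set_integral_diff) (auto intro!: I continuous_intros i1 cont)
    finally show ?thesis .
  qed
  ultimately have QF: "(lam * \<kappa>)\<^sup>2 * (LINT p:rect T|lborel. F p)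
      + lam * \<kappa> * ((LINT p:rect T|lborel. Gx p) - \<beta> * (LINT p:rect T|lborel. Gt p))
      \<le> (LINT p:rect T|lborel. Q p)"
    and x: "- sqnorm {0<..<T} (\<lambda>t. v (0, t)) \<le> (LINT p:rect T|lborel. Gx p)"
    and t: "(LINT p:rect T|lborel. Gt p) \<le> exp (- 2 * lam * \<alpha> * T) * sqnorm {0<..<1} (\<lambda>x. v (x, T))
      - (LINT x:{0<..<1}|lborel. (v (x, 0))\<^sup>2 * exp (- 2 * lam * x))"
    unfolding split by blast+
  have "lam * \<kappa> * (- sqnorm {0<..<T} (\<lambda>t. v (0, t)) - \<beta> * (exp (- 2 * lam * \<alpha> * T)
        * sqnorm {0<..<1} (\<lambda>x. v (x, T)) - (LINT x:{0<..<1}|lborel. (v (x, 0))\<^sup>2 * exp (- 2 * lam * x))))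
      \<le> lam * \<kappa> * ((LINT p:rect T|lborel. Gx p) - \<beta> * (LINT p:rect T|lborel. Gt p))"
    by (intro mult_left_mono diff_mono x t) (use pos k in auto)
  with QF have "(lam * \<kappa>)\<^sup>2 * (LINT p:rect T|lborel. F p) + lam * \<kappa> * (- sqnorm {0<..<T} (\<lambda>t. v (0, t))
        - \<beta> * (exp (- 2 * lam * \<alpha> * T) * sqnorm {0<..<1} (\<lambda>x. v (x, T))
        - (LINT x:{0<..<1}|lborel. (v (x, 0))\<^sup>2 * exp (- 2 * lam * x))))
      \<le> (LINT p:rect T|lborel. Q p)"
    by linarith
  then show ?thesis by (simp add: F_def Q_def algebra_simps)
qed

lemma sqnorm_zero [simp]: "sqnorm S (\<lambda>_. 0) = 0"
  by (simp add: sqnorm_def set_lebesgue_integral_def)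

text \<open>The transport estimate with \<open>\<alpha> = \<beta> = 0\<close> and \<open>lam = 1\<close>, where the weight \<open>exp (- 2 x)\<close> lies between
  \<open>exp (- 2)\<close> and \<open>1\<close>.\<close>

lemma poincare_left:
  assumes v: "smooth v" and T: "0 \<le> T"
  shows "sqnorm (rect T) v \<le> exp 2 * (sqnorm (rect T) (pd_x v) + sqnorm {0<..<T} (\<lambda>t. v (0, t)))"
proof -
  let ?w = "carleman_weight 0 1"
  note int = continuous_set_integrable[OF _ rect_borel rect_bounded]
  note cont = smooth_continuous[OF v] smooth_continuous[OF smooth_pd_x[OF v]]
  have w: "exp (- 2) \<le> ?w p" "?w p \<le> 1" if "p \<in> rect T" for p
    using that by (auto simp: carleman_weight_def rect_def)
  have "exp (- 2) * sqnorm (rect T) v = (LINT p:rect T|lborel. exp (- 2) * (v p)\<^sup>2)"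
    by (simp add: sqnorm_def)
  also have "\<dots> \<le> (LINT p:rect T|lborel. (v p)\<^sup>2 * ?w p)"
  proof (rule set_integral_mono[OF int int])
    fix p assume "p \<in> rect T"
    then show "exp (- 2) * (v p)\<^sup>2 \<le> (v p)\<^sup>2 * ?w p"
      using w(1) by (subst mult.commute) (intro mult_left_mono, auto)
  qed (intro continuous_intros cont continuous_carleman_weight)+
  also have "\<dots> \<le> (LINT p:rect T|lborel. (pd_x v p)\<^sup>2 * ?w p) + sqnorm {0<..<T} (\<lambda>t. v (0, t))"
    using transport_estimate[OF v, of 0 0 1 T 1] T by simp
  also have "(LINT p:rect T|lborel. (pd_x v p)\<^sup>2 * ?w p) \<le> sqnorm (rect T) (pd_x v)"
    unfolding sqnorm_def
  proof (rule set_integral_mono[OF int int])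
    fix p assume "p \<in> rect T"
    then show "(pd_x v p)\<^sup>2 * ?w p \<le> (pd_x v p)\<^sup>2"
      using w(2) by (intro mult_left_le) auto
  qed (intro continuous_intros cont continuous_carleman_weight)+
  finally have "exp 2 * (exp (- 2) * sqnorm (rect T) v)
      \<le> exp 2 * (sqnorm (rect T) (pd_x v) + sqnorm {0<..<T} (\<lambda>t. v (0, t)))"
    by simp
  moreover have "exp 2 * (exp (- 2) * x) = x" for x :: real by (simp add: exp_minus)
  ultimately show ?thesis by simp
qed

text \<open>Integrate \<open>\<partial>\<^sub>t ((t - T + \<tau>) w\<^sup>2)\<close>: the linear factor vanishes at the end of \<open>[0, T]\<close> opposite to \<open>\<tau>\<close>
  and has modulus \<open>T\<close> at \<open>\<tau>\<close>, with the sign of the outward normal.\<close>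

lemma trace_inequality:
  assumes w: "smooth w" and T: "0 \<le> T" and \<tau>: "\<tau> = 0 \<or> \<tau> = T"
  shows "T * sqnorm {0<..<1} (\<lambda>x. w (x, \<tau>))
    \<le> (1 + T) * (sqnorm (rect T) w + sqnorm (rect T) (pd_t w))"
proof -
  define F where "F p = (snd p - T + \<tau>) * (w p)\<^sup>2" for p
  define G where "G p = (w p)\<^sup>2 + (snd p - T + \<tau>) * (2 * w p * pd_t w p)" for p
  note cont = smooth_continuous[OF w] smooth_continuous[OF smooth_pd_t[OF w]]
  note int = continuous_set_integrable[OF _ rect_borel rect_bounded]
  have cG: "continuous_on UNIV G"
    unfolding G_def[abs_def] by (intro continuous_intros cont)
  have DF: "((\<lambda>s. F (x, s)) has_real_derivative G (x, t)) (at t)" for x t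
    unfolding F_def G_def fst_conv snd_conv
    by (rule derivative_eq_intros smooth_DERIV_t[OF w] refl)+ (simp add: algebra_simps power2_eq_square)
  have "T * sqnorm {0<..<1} (\<lambda>x. w (x, \<tau>)) = (LINT x:{0<..<1}|lborel. F (x, T) - F (x, 0))"
    using \<tau>
  proof
    assume "\<tau> = 0"
    then show ?thesis by (simp add: F_def sqnorm_def)
  next
    assume "\<tau> = T"
    then show ?thesis by (simp add: F_def sqnorm_def)
  qed
  also have "\<dots> = (LINT p:rect T|lborel. G p)"
    by (rule rect_integral_t_derivative[OF T cG DF, symmetric])
  also have "\<dots> \<le> (LINT p:rect T|lborel. (1 + T) * ((w p)\<^sup>2 + (pd_t w p)\<^sup>2))"
  proof (rule set_integral_mono[OF int[OF cG] int])
    fix p assume p: "p \<in> rect T"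
    have "\<bar>snd p - T + \<tau>\<bar> \<le> T" using p \<tau> by (auto simp: rect_def)
    moreover have "\<bar>2 * w p * pd_t w p\<bar> \<le> (w p)\<^sup>2 + (pd_t w p)\<^sup>2"
      using zero_le_power2[of "w p - pd_t w p"] zero_le_power2[of "w p + pd_t w p"]
      by (auto simp: power2_diff power2_sum abs_le_iff)
    ultimately have "\<bar>(snd p - T + \<tau>) * (2 * w p * pd_t w p)\<bar> \<le> T * ((w p)\<^sup>2 + (pd_t w p)\<^sup>2)"
      unfolding abs_mult[of "snd p - T + \<tau>"] by (intro mult_mono) (use T in auto)
    then have "(snd p - T + \<tau>) * (2 * w p * pd_t w p) \<le> T * ((w p)\<^sup>2 + (pd_t w p)\<^sup>2)"
      by (rule abs_le_D1)
    moreover have "0 \<le> (pd_t w p)\<^sup>2" by simp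
    ultimately have "G p \<le> ((w p)\<^sup>2 + (pd_t w p)\<^sup>2) + T * ((w p)\<^sup>2 + (pd_t w p)\<^sup>2)"
      unfolding G_def by (intro add_mono) auto
    then show "G p \<le> (1 + T) * ((w p)\<^sup>2 + (pd_t w p)\<^sup>2)"
      by (simp add: distrib_right)
  qed (intro continuous_intros cont)
  also have "\<dots> = (1 + T) * (sqnorm (rect T) w + sqnorm (rect T) (pd_t w))"
    using int[OF continuous_on_power[OF cont(1)], of T 2] int[OF continuous_on_power[OF cont(2)], of T 2]
    by (simp add: sqnorm_def set_integral_add)
  finally show ?thesis .
qed

text \<open>Let \<open>U\<close> be the primitive of \<open>v\<close> and \<open>W = U\<^sub>x - 2 U\<^sub>t\<close>.  The second order operator factors in two ways,
  \<open>(\<partial>\<^sub>x - 2 \<partial>\<^sub>t) U\<^sub>x = \<partial>\<^sub>x W\<close>, and the transport estimate applies to \<open>v = U\<^sub>x\<close>, to \<open>W\<close> and to \<open>U\<close>.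
  The estimate of \<open>v\<close> bounds \<open>U\<^sub>x\<close>; those of \<open>W\<close> and \<open>U\<close> together bound \<open>U\<close>; and
  \<open>U\<^sub>t = (v - W) / 2\<close>.  On \<open>x = 0\<close> both \<open>U\<close> and \<open>U\<^sub>t\<close> vanish, so \<open>W = v\<close> there and only the trace of
  \<open>v\<close> remains as an error.

  The three estimates are added with the weights \<open>1/4\<close>, \<open>1/2\<close> and \<open>lam\<^sup>2 / 4\<close>.  These give the
  boundary terms of \<open>U\<^sub>x\<close> and \<open>U\<close> on \<open>t = 0\<close> and \<open>t = T\<close> exactly the coefficient \<open>\<kappa> / 2\<close>, and leave a
  quarter of \<open>lam\<^sup>2 W\<^sup>2\<close> for \<open>U\<^sub>t\<close>.  The interior terms carry one more power of \<open>lam\<close> than required, and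
  \<open>lam \<ge> 3 / \<kappa>\<close> makes them large enough.\<close>

lemma smooth_carleman_estimate:
  assumes v: "smooth v" and \<alpha>: "0 < \<alpha>" "\<alpha> < 1 / 2" and k: "\<kappa> = 1 - 2 * \<alpha>"
    and lam: "lam \<ge> 3 / \<kappa>" and T: "0 \<le> T"
  shows "\<kappa> / 2 * lam * (LINT p:rect T|lborel. (v p)\<^sup>2 * carleman_weight \<alpha> lam p)
      + \<kappa> / 2 * lam * (LINT p:rect T|lborel. (x_primitive (pd_t v) p)\<^sup>2 * carleman_weight \<alpha> lam p)
      + \<kappa> / 2 * lam ^ 3 * (LINT p:rect T|lborel. (x_primitive v p)\<^sup>2 * carleman_weight \<alpha> lam p)
      + \<kappa> / 2 * lam * (LINT x:{0<..<1}|lborel. (v (x, 0))\<^sup>2 * exp (- 2 * lam * x))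
      + \<kappa> / 2 * lam ^ 3 * (LINT x:{0<..<1}|lborel. (x_primitive v (x, 0))\<^sup>2 * exp (- 2 * lam * x))
    \<le> (LINT p:rect T|lborel. (pd_x v p - 2 * pd_t v p)\<^sup>2 * carleman_weight \<alpha> lam p)
      + lam * sqnorm {0<..<T} (\<lambda>t. v (0, t))
      + \<kappa> / 2 * lam * exp (- 2 * lam * \<alpha> * T) * sqnorm {0<..<1} (\<lambda>x. v (x, T))
      + \<kappa> / 2 * lam ^ 3 * exp (- 2 * lam * \<alpha> * T) * sqnorm {0<..<1} (\<lambda>x. x_primitive v (x, T))"
    (is "_ * ?A + _ * ?B + _ * ?D + _ * ?P0 + _ * ?Q0 \<le> ?F + _ * ?E + _ * ?PT + _ * ?QT")
proof -
  let ?w = "carleman_weight \<alpha> lam"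
  define U where "U = x_primitive v"
  define W where "W p = v p - 2 * pd_t U p" for p
  have U: "smooth U" and Ux: "pd_x U = v" and Ut: "pd_t U = x_primitive (pd_t v)"
    unfolding U_def using v by (simp_all add: smooth_x_primitive pd_x_x_primitive pd_t_x_primitive)
  have Utx: "pd_x (pd_t U) = pd_t v" unfolding Ut by (rule pd_x_x_primitive[OF smooth_pd_t[OF v]])
  have W: "smooth W" and Wx: "pd_x W = (\<lambda>p. pd_x v p - 2 * pd_t v p)"
    unfolding W_def[abs_def] using smooth_lincomb[OF v smooth_pd_t[OF U], of "- 2"]
      pd_x_lincomb[OF v smooth_pd_t[OF U], of "- 2"] by (simp_all add: Utx)
  have kp: "0 < \<kappa>" "\<kappa> < 1" using \<alpha> by (auto simp: k)
  have lk: "3 \<le> lam * \<kappa>" using lam kp by (simp add: field_simps)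
  have "3 \<le> 3 / \<kappa>" using kp by (simp add: field_simps)
  with lam have l: "3 \<le> lam" by linarith
  define WW where "WW = (LINT p:rect T|lborel. (W p)\<^sup>2 * ?w p)"
  have e1: "(lam * \<kappa>)\<^sup>2 * ?A + 2 * lam * \<kappa> * ?P0
      \<le> ?F + lam * \<kappa> * ?E + 2 * lam * \<kappa> * exp (- 2 * lam * \<alpha> * T) * ?PT"
    using transport_estimate[OF v, of \<alpha> 2 lam T \<kappa>] \<alpha> l T k kp by simp
  have U0: "U (0, t) = 0" for t by (simp add: U_def x_primitive_left)
  have W0: "W (0, t) = v (0, t)" for t by (simp add: W_def Ut x_primitive_left)
  have e2: "lam\<^sup>2 * WW \<le> ?F + lam * ?E"
    using transport_estimate[OF W, of \<alpha> 0 lam T 1] \<alpha> l T by (simp add: Wx W0 WW_def)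
  have e3: "(lam * \<kappa>)\<^sup>2 * ?D + 2 * lam * \<kappa> * ?Q0
      \<le> WW + 2 * lam * \<kappa> * exp (- 2 * lam * \<alpha> * T) * ?QT"
    using transport_estimate[OF U, of \<alpha> 2 lam T \<kappa>] \<alpha> l T k kp
    unfolding U_def[symmetric] by (simp add: Ux WW_def W_def U0)
  note cont = smooth_continuous[OF v] smooth_continuous[OF W] smooth_continuous[OF smooth_pd_t[OF U]]
    smooth_continuous[OF U] smooth_continuous[OF smooth_pd_x[OF v]] smooth_continuous[OF smooth_pd_t[OF v]]
  note int = continuous_set_integrable[OF _ rect_borel rect_bounded]
  have e4: "?B \<le> ?A / 2 + WW / 2"
  proof -
    have "?B \<le> (LINT p:rect T|lborel. (v p)\<^sup>2 * ?w p / 2 + (W p)\<^sup>2 * ?w p / 2)"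
      unfolding Ut[symmetric]
    proof (rule set_integral_mono[OF int int])
      fix p
      have "4 * (pd_t U p)\<^sup>2 = (v p - W p)\<^sup>2" by (simp add: W_def power2_eq_square)
      also have "\<dots> \<le> 2 * (v p)\<^sup>2 + 2 * (W p)\<^sup>2"
        using zero_le_power2[of "v p + W p"] by (simp add: power2_diff power2_sum)
      finally have "(pd_t U p)\<^sup>2 \<le> (v p)\<^sup>2 / 2 + (W p)\<^sup>2 / 2" by simp
      from mult_right_mono[OF this less_imp_le[OF carleman_weight_pos]]
      show "(pd_t U p)\<^sup>2 * ?w p \<le> (v p)\<^sup>2 * ?w p / 2 + (W p)\<^sup>2 * ?w p / 2"
        by (simp add: distrib_right)
    qed (intro continuous_intros cont continuous_carleman_weight; simp)+
    also have "\<dots> = ?A / 2 + WW / 2"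
      unfolding WW_def
      by (subst set_integral_add) (auto intro!: int continuous_intros cont continuous_carleman_weight)
    finally show ?thesis .
  qed
  have pos: "0 \<le> ?A" "0 \<le> ?D" "0 \<le> WW" "0 \<le> ?F" "0 \<le> ?E"
    unfolding WW_def
    by (auto intro!: set_integral_nonneg_real mult_nonneg_nonneg less_imp_le[OF carleman_weight_pos] sqnorm_nonneg)
  have "\<kappa> / 2 * lam * ?A + \<kappa> / 2 * lam * ?B \<le> \<kappa> / 2 * lam * ?A + \<kappa> / 2 * lam * (?A / 2 + WW / 2)"
    using e4 kp l by (intro add_left_mono mult_left_mono) auto
  also have "\<dots> = 3 / 4 * (lam * \<kappa> * ?A) + \<kappa> * (lam * WW) / 4" by (simp add: algebra_simps)
  also have "\<dots> \<le> (lam * \<kappa>)\<^sup>2 * ?A / 4 + lam\<^sup>2 * WW / 4"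
  proof -
    have "3 * (lam * \<kappa> * ?A) \<le> lam * \<kappa> * (lam * \<kappa> * ?A)"
      using lk pos kp l by (intro mult_right_mono) auto
    moreover have "\<kappa> * (lam * WW) \<le> lam * (lam * WW)"
      using kp l pos by (intro mult_right_mono) auto
    ultimately show ?thesis by (simp add: power2_eq_square algebra_simps)
  qed
  finally have s1: "\<kappa> / 2 * lam * ?A + \<kappa> / 2 * lam * ?B \<le> (lam * \<kappa>)\<^sup>2 * ?A / 4 + lam\<^sup>2 * WW / 4" .
  have s2: "\<kappa> / 2 * lam ^ 3 * ?D \<le> lam\<^sup>2 / 4 * ((lam * \<kappa>)\<^sup>2 * ?D)"
  proof -
    have "3 * (\<kappa> * lam ^ 3 * ?D) \<le> lam * \<kappa> * (\<kappa> * lam ^ 3 * ?D)"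
      using lk pos kp l by (intro mult_right_mono) auto
    moreover have "0 \<le> \<kappa> * lam ^ 3 * ?D" using kp l pos by simp
    ultimately show ?thesis by (simp add: power2_eq_square power3_eq_cube algebra_simps)
  qed
  have s3: "lam * \<kappa> * ?E / 4 \<le> lam * ?E / 4"
    using kp l pos by (simp add: mult_right_le_one_le mult_right_mono)
  from mult_left_mono[OF e3, of "lam\<^sup>2 / 4"]
  have e3': "lam\<^sup>2 / 4 * ((lam * \<kappa>)\<^sup>2 * ?D) + \<kappa> / 2 * lam ^ 3 * ?Q0
      \<le> lam\<^sup>2 * WW / 4 + \<kappa> / 2 * lam ^ 3 * exp (- 2 * lam * \<alpha> * T) * ?QT"
    by (simp add: power2_eq_square power3_eq_cube algebra_simps)
  from e1 have e1': "(lam * \<kappa>)\<^sup>2 * ?A / 4 + \<kappa> / 2 * lam * ?P0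
      \<le> ?F / 4 + lam * \<kappa> * ?E / 4 + \<kappa> / 2 * lam * exp (- 2 * lam * \<alpha> * T) * ?PT"
    by (simp add: algebra_simps)
  have "2 * (x / 4) \<le> f / 2 + e / 2" if "x \<le> f + e" for x f e :: real using that by linarith
  note e2' = this[OF e2]
  have sum: "a + b + d + p + q \<le> f + e + r + t"
    if "a + b \<le> a' + w'" "d \<le> d'" "d' + q \<le> w' + t" "a' + p \<le> f / 4 + e' + r" "e' \<le> e / 4"
      "2 * w' \<le> f / 2 + e / 2" "0 \<le> f" "0 \<le> e" for a b d p q f e r t a' w' d' e' :: real
    using that by linarith
  show ?thesis
    by (rule sum[OF s1 s2 e3' e1' s3 e2' pos(4)]) (use pos l in simp)
qed

section \<open>Approximation and traces\<close>

lemma smooth_L2_on_rect: "smooth f \<Longrightarrow> L2_on (rect T) f"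
  by (intro continuous_L2_on smooth_continuous rect_borel rect_bounded)

lemma smooth_L2_on_slice:
  assumes "smooth f"
  shows "L2_on {a<..<b} (\<lambda>x. f (x, \<tau>))" and "L2_on {a<..<b} (\<lambda>t. f (x, t))"
  by (rule continuous_L2_on; (intro continuous_comp_UNIV[OF smooth_continuous[OF assms]] continuous_intros)?; simp)+

text \<open>A polynomial that vanishes at both ends of \<open>[0, T]\<close> and tends to \<open>1\<close> on the open interval as
  \<open>k\<close> grows.\<close>

definition time_cutoff :: "real \<Rightarrow> nat \<Rightarrow> real \<Rightarrow> real" where
  "time_cutoff T k t = 1 - (1 - 2 * t / T) ^ (2 * Suc k)"

lemma time_cutoff_ends: "0 < T \<Longrightarrow> time_cutoff T k 0 = 0" "0 < T \<Longrightarrow> time_cutoff T k T = 0"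
  by (simp_all add: time_cutoff_def)

lemma time_cutoff_bounds:
  assumes "0 < t" "t < T"
  shows "0 \<le> time_cutoff T k t" "time_cutoff T k t \<le> 1" "(\<lambda>k. time_cutoff T k t) \<longlonglongrightarrow> 1"
proof -
  let ?y = "(1 - 2 * t / T)\<^sup>2"
  have eq: "time_cutoff T k t = 1 - ?y ^ Suc k" for k
    unfolding time_cutoff_def power_mult ..
  have "\<bar>1 - 2 * t / T\<bar> < 1" using assms by (simp add: abs_less_iff field_simps)
  then have y: "?y < 1" by (simp add: abs_square_less_1)
  then have "?y ^ Suc k \<le> 1" by (rule power_le_one[OF zero_le_power2 less_imp_le])
  then show "0 \<le> time_cutoff T k t" unfolding eq by linarith
  have "0 \<le> ?y ^ Suc k" by (rule zero_le_power[OF zero_le_power2])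
  then show "time_cutoff T k t \<le> 1" unfolding eq by linarith
  show "(\<lambda>k. time_cutoff T k t) \<longlonglongrightarrow> 1"
    unfolding eq using tendsto_diff[OF tendsto_const LIMSEQ_Suc[OF LIMSEQ_realpow_zero[OF zero_le_power2 y]], of 1]
    by simp
qed

text \<open>Closability of \<open>\<partial>\<^sub>t\<close> in \<open>L2\<close>, for sequences whose time derivatives are Cauchy.  Let \<open>a\<close> be the derivative
  of \<open>d m\<close> for a late \<open>m\<close>, and \<open>c\<close> a cutoff that vanishes at \<open>t = 0\<close> and \<open>t = T\<close>.  Integration by parts
  shows that \<open>\<integral> c a \<partial>\<^sub>t (d n)\<close> tends to zero as \<open>n\<close> grows, since \<open>d n\<close> does.  As \<open>\<partial>\<^sub>t (d n)\<close> stays close to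
  \<open>a\<close>, the integral of \<open>c a\<^sup>2\<close> is small, uniformly in \<open>c\<close>; the cutoff is then removed by dominated
  convergence.\<close>

lemma time_derivative_closable:
  assumes T: "0 < T" and d: "\<And>n. smooth (d n)" and lim: "(\<lambda>n. sqnorm (rect T) (d n)) \<longlonglongrightarrow> 0"
    and C: "\<And>e. e > 0 \<Longrightarrow>
      \<exists>N. \<forall>m\<ge>N. \<forall>n\<ge>N. sqnorm (rect T) (\<lambda>p. pd_t (d m) p - pd_t (d n) p) < e"
  shows "(\<lambda>n. sqnorm (rect T) (pd_t (d n))) \<longlonglongrightarrow> 0"
proof (rule LIMSEQ_I)
  fix e :: real assume e: "e > 0"
  obtain N where N: "\<And>m n. m \<ge> N \<Longrightarrow> n \<ge> N \<Longrightarrow>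
      sqnorm (rect T) (\<lambda>p. pd_t (d m) p - pd_t (d n) p) < e / 2"
    using C[of "e / 2"] e by auto
  note int = continuous_set_integrable[OF _ rect_borel rect_bounded]
  have cchi: "continuous_on UNIV (\<lambda>p. time_cutoff T k (snd p))" for k
    unfolding time_cutoff_def using T by (intro continuous_intros) auto
  have "sqnorm (rect T) (pd_t (d m)) \<le> e / 2" if m: "m \<ge> N" for m
  proof -
    define a where "a = pd_t (d m)"
    have a: "smooth a" unfolding a_def by (intro smooth_pd_t d)
    note ca = smooth_continuous[OF a] smooth_continuous[OF smooth_pd_t[OF a]]
    have cut: "(LINT p:rect T|lborel. time_cutoff T k (snd p) * (a p)\<^sup>2) \<le> e / 2" for k
    proof -
      let ?c = "\<lambda>p. time_cutoff T k (snd p)"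
      define c' where "c' p = real (2 * Suc k) * (1 - 2 * snd p / T) ^ (2 * Suc k - 1) * (2 / T)"
        for p :: "real \<times> real"
      have Dc: "(time_cutoff T k has_real_derivative c' (x, t)) (at t)" for x t
        unfolding time_cutoff_def c'_def snd_conv using T
        by (auto intro!: derivative_eq_intros simp del: power_Suc)
      have cc': "continuous_on UNIV c'" unfolding c'_def using T by (intro continuous_intros) auto
      define z where "z p = c' p * a p + ?c p * pd_t a p" for p
      have cz: "continuous_on UNIV z" unfolding z_def by (intro continuous_intros cc' cchi ca)
      have byparts: "(LINT p:rect T|lborel. ?c p * a p * pd_t (d n) p) = - (LINT p:rect T|lborel. d n p * z p)"
        for n
      proof -
        note cd = smooth_continuous[OF d[of n]] smooth_continuous[OF smooth_pd_t[OF d[of n]]]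
        have "(LINT p:rect T|lborel. ?c p * a p * pd_t (d n) p + d n p * z p)
            = (LINT x:{0<..<1}|lborel. ?c (x, T) * a (x, T) * d n (x, T) - ?c (x, 0) * a (x, 0) * d n (x, 0))"
        proof (rule rect_integral_t_derivative[where F = "\<lambda>p. ?c p * a p * d n p"])
          show "continuous_on UNIV (\<lambda>p. ?c p * a p * pd_t (d n) p + d n p * z p)"
            by (intro continuous_intros cchi ca cd cz)
          show "((\<lambda>s. ?c (x, s) * a (x, s) * d n (x, s)) has_real_derivative
              ?c (x, t) * a (x, t) * pd_t (d n) (x, t) + d n (x, t) * z (x, t)) (at t)" for x t
            unfolding z_def snd_conv
            by (rule derivative_eq_intros smooth_DERIV_t[OF a] smooth_DERIV_t[OF d] Dc[of x] refl)+
               (simp add: algebra_simps)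
        qed (use T in simp)
        also have "\<dots> = 0" using T by (simp add: time_cutoff_ends)
        also have "(LINT p:rect T|lborel. ?c p * a p * pd_t (d n) p + d n p * z p)
            = (LINT p:rect T|lborel. ?c p * a p * pd_t (d n) p) + (LINT p:rect T|lborel. d n p * z p)"
          by (rule set_integral_add(2); intro int continuous_intros cchi ca cd cz)
        finally show ?thesis by linarith
      qed
      have "(\<lambda>n. LINT p:rect T|lborel. d n p * z p) \<longlonglongrightarrow> 0"
        by (intro L2_product_tendsto_zero rect_borel smooth_L2_on_rect d lim
            continuous_L2_on[OF cz] rect_bounded)
      then have B: "(\<lambda>n. e / 2 + 2 * (LINT p:rect T|lborel. ?c p * a p * pd_t (d n) p)) \<longlonglongrightarrow> e / 2 + 2 * - 0"
        unfolding byparts by (intro tendsto_intros)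
      have "(LINT p:rect T|lborel. ?c p * (a p)\<^sup>2)
          \<le> e / 2 + 2 * (LINT p:rect T|lborel. ?c p * a p * pd_t (d n) p)" if n: "n \<ge> N" for n
      proof -
        let ?b = "pd_t (d n)"
        note cb = smooth_continuous[OF smooth_pd_t[OF d[of n]]]
        have "(LINT p:rect T|lborel. ?c p * (a p)\<^sup>2)
            \<le> (LINT p:rect T|lborel. (a p - ?b p)\<^sup>2 + 2 * (?c p * a p * ?b p))"
        proof (rule set_integral_mono[OF int int])
          fix p assume "p \<in> rect T"
          then have c: "0 \<le> ?c p" "?c p \<le> 1"
            using time_cutoff_bounds by (auto simp: rect_def)
          have "?c p * (a p)\<^sup>2 \<le> ?c p * (a p)\<^sup>2 + ?c p * (?b p)\<^sup>2" using c by simp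
          also have "\<dots> = ?c p * (a p - ?b p)\<^sup>2 + 2 * (?c p * a p * ?b p)"
            by (simp add: power2_diff algebra_simps)
          also have "?c p * (a p - ?b p)\<^sup>2 \<le> (a p - ?b p)\<^sup>2" using c by (intro mult_left_le_one_le) auto
          finally show "?c p * (a p)\<^sup>2 \<le> (a p - ?b p)\<^sup>2 + 2 * (?c p * a p * ?b p)" by simp
        qed (intro continuous_intros cchi ca cb)+
        also have "\<dots> = sqnorm (rect T) (\<lambda>p. a p - ?b p) + 2 * (LINT p:rect T|lborel. ?c p * a p * ?b p)"
          unfolding sqnorm_def
          by (subst set_integral_add(2)) (intro int continuous_intros cchi ca cb | simp)+
        finally show ?thesis using N[OF m n] by (simp add: a_def)
      qed
      then show ?thesis using LIMSEQ_le_const[OF B] by auto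
    qed
    have "(\<lambda>k. LINT p:rect T|lborel. time_cutoff T k (snd p) * (a p)\<^sup>2) \<longlonglongrightarrow> sqnorm (rect T) a"
      unfolding sqnorm_def set_lebesgue_integral_def
    proof (rule integral_dominated_convergence[where w = "\<lambda>p. indicator (rect T) p *\<^sub>R (a p)\<^sup>2"])
      show "integrable lborel (\<lambda>p. indicator (rect T) p *\<^sub>R (a p)\<^sup>2)"
        using int[of "\<lambda>p. (a p)\<^sup>2" T] ca by (simp add: set_integrable_def continuous_on_power)
      then show "(\<lambda>p. indicator (rect T) p *\<^sub>R (a p)\<^sup>2) \<in> borel_measurable lborel" by measurable
      have "set_integrable lborel (rect T) (\<lambda>p. time_cutoff T k (snd p) * (a p)\<^sup>2)" for k
        by (intro int continuous_intros cchi ca)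
      then show "(\<lambda>p. indicator (rect T) p *\<^sub>R (time_cutoff T k (snd p) * (a p)\<^sup>2)) \<in> borel_measurable lborel" for k
        unfolding set_integrable_def by (rule borel_measurable_integrable)
      show "AE p in lborel. (\<lambda>k. indicator (rect T) p *\<^sub>R (time_cutoff T k (snd p) * (a p)\<^sup>2))
          \<longlonglongrightarrow> indicator (rect T) p *\<^sub>R (a p)\<^sup>2"
      proof (rule AE_I2)
        fix p :: "real \<times> real"
        show "(\<lambda>k. indicator (rect T) p *\<^sub>R (time_cutoff T k (snd p) * (a p)\<^sup>2))
          \<longlonglongrightarrow> indicator (rect T) p *\<^sub>R (a p)\<^sup>2"
        proof (cases "p \<in> rect T")
          case True
          then have "(\<lambda>k. time_cutoff T k (snd p)) \<longlonglongrightarrow> 1"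
            using time_cutoff_bounds(3) by (auto simp: rect_def)
          from tendsto_mult_right[OF this, of "(a p)\<^sup>2"] True show ?thesis by simp
        qed simp
      qed
      show "AE p in lborel. norm (indicator (rect T) p *\<^sub>R (time_cutoff T k (snd p) * (a p)\<^sup>2))
          \<le> indicator (rect T) p *\<^sub>R (a p)\<^sup>2" for k
      proof (rule AE_I2)
        fix p :: "real \<times> real"
        show "norm (indicator (rect T) p *\<^sub>R (time_cutoff T k (snd p) * (a p)\<^sup>2))
          \<le> indicator (rect T) p *\<^sub>R (a p)\<^sup>2"
        proof (cases "p \<in> rect T")
          case True
          then have "0 \<le> time_cutoff T k (snd p)" "time_cutoff T k (snd p) \<le> 1"
            using time_cutoff_bounds by (auto simp: rect_def)
          then show ?thesis using True by (simp add: mult_left_le_one_le)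
        qed simp
      qed
    qed
    then have "sqnorm (rect T) a \<le> e / 2" by (rule LIMSEQ_le_const2) (use cut in blast)
    then show ?thesis by (simp add: a_def)
  qed
  then show "\<exists>N. \<forall>n\<ge>N. norm (sqnorm (rect T) (pd_t (d n)) - 0) < e"
    using e by (intro exI[of _ N]) (force simp: sqnorm_nonneg)
qed

lemma wd_x_L2_on:
  assumes "u \<in> H1 \<Omega>"
  shows "L2_on \<Omega> (wd_x \<Omega> u)"
proof -
  have "\<exists>v. has_weak_x \<Omega> u v" using assms by (simp add: H1_def)
  then have "has_weak_x \<Omega> u (wd_x \<Omega> u)" unfolding wd_x_def by (rule someI_ex)
  then show ?thesis by (simp add: has_weak_x_def)
qed

lemma wd_t_L2_on:
  assumes "u \<in> H1 \<Omega>"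
  shows "L2_on \<Omega> (wd_t \<Omega> u)"
proof -
  have "\<exists>v. has_weak_t \<Omega> u v" using assms by (simp add: H1_def)
  then have "has_weak_t \<Omega> u (wd_t \<Omega> u)" unfolding wd_t_def by (rule someI_ex)
  then show ?thesis by (simp add: has_weak_t_def)
qed

lemma H1_L2_on: "u \<in> H1 \<Omega> \<Longrightarrow> L2_on \<Omega> u"
  by (simp add: H1_def)

text \<open>\<open>trace_at_time\<close> is a choice, so it says something only once a trace exists.  An approximating sequence
  supplies one: by the trace inequality its restrictions form a Cauchy sequence.  The same inequality,
  applied to the difference of two approximating sequences, shows that the chosen trace is the limit
  along every such sequence.\<close>

lemma trace_at_time_limit:
  assumes T: "0 < T" and \<tau>: "\<tau> = 0 \<or> \<tau> = T" and f: "f \<in> H1 (rect T)"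
    and z: "\<And>n. smooth (z n)" and lim: "H1_tendsto (rect T) z f"
  shows "L2_on {0<..<1} (trace_at_time T \<tau> f)"
    and "L2_tendsto {0<..<1} (\<lambda>n x. z n (x, \<tau>)) (trace_at_time T \<tau> f)"
proof -
  have bnd: "sqnorm {0<..<1} (\<lambda>x. w (x, \<tau>) - w' (x, \<tau>))
      \<le> (1 + T) / T * (sqnorm (rect T) (\<lambda>p. w p - w' p) + sqnorm (rect T) (\<lambda>p. pd_t w p - pd_t w' p))"
    if "smooth w" "smooth w'" for w w'
    using trace_inequality[OF smooth_diff[OF that] less_imp_le[OF T] \<tau>] T
    by (simp add: pd_t_diff[OF that] field_simps)
  have lims: "L2_tendsto (rect T) z f" "L2_tendsto (rect T) (\<lambda>n. pd_t (z n)) (wd_t (rect T) f)"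
    using lim by (auto simp: H1_tendsto_def)
  have "\<exists>g. L2_on {0<..<1} g \<and> L2_tendsto {0<..<1} (\<lambda>n x. z n (x, \<tau>)) g"
  proof (rule L2_complete)
    fix e :: real assume e: "e > 0"
    define r where "r = e / 2 * (T / (1 + T))"
    have r: "r > 0" using e T by (simp add: r_def)
    obtain N1 where N1: "\<And>m n. m \<ge> N1 \<Longrightarrow> n \<ge> N1 \<Longrightarrow> sqnorm (rect T) (\<lambda>p. z m p - z n p) < r"
      using L2_tendsto_Cauchy[OF rect_borel smooth_L2_on_rect[OF z] H1_L2_on[OF f] lims(1) r] by auto
    obtain N2 where N2: "\<And>m n. m \<ge> N2 \<Longrightarrow> n \<ge> N2 \<Longrightarrow>
        sqnorm (rect T) (\<lambda>p. pd_t (z m) p - pd_t (z n) p) < r"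
      using L2_tendsto_Cauchy[OF rect_borel smooth_L2_on_rect[OF smooth_pd_t[OF z]] wd_t_L2_on[OF f] lims(2) r]
      by auto
    have "sqnorm {0<..<1} (\<lambda>x. z m (x, \<tau>) - z n (x, \<tau>)) < e" if "m \<ge> max N1 N2" "n \<ge> max N1 N2" for m n
    proof -
      have "sqnorm (rect T) (\<lambda>p. z m p - z n p) + sqnorm (rect T) (\<lambda>p. pd_t (z m) p - pd_t (z n) p) < r + r"
        using that by (intro add_strict_mono N1 N2) auto
      then have "(1 + T) / T * (sqnorm (rect T) (\<lambda>p. z m p - z n p)
          + sqnorm (rect T) (\<lambda>p. pd_t (z m) p - pd_t (z n) p)) < (1 + T) / T * (r + r)"
        using T by (intro mult_strict_left_mono) auto
      also have "r + r = e * (T / (1 + T))" unfolding r_def distrib_right[symmetric] by simp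
      also have "(1 + T) / T * (e * (T / (1 + T))) = e" using T by simp
      finally show ?thesis using bnd[OF z z, of m n] by linarith
    qed
    then show "\<exists>N. \<forall>m\<ge>N. \<forall>n\<ge>N. sqnorm {0<..<1} (\<lambda>x. z m (x, \<tau>) - z n (x, \<tau>)) < e" by blast
  qed (auto intro: smooth_L2_on_slice z)
  then obtain g where "L2_on {0<..<1} g" "L2_tendsto {0<..<1} (\<lambda>n x. z n (x, \<tau>)) g" by blast
  then have "has_trace (rect T) (\<lambda>x. (x, \<tau>)) {0<..<1} f g"
    using f z lim by (auto simp: has_trace_def)
  then have tr: "has_trace (rect T) (\<lambda>x. (x, \<tau>)) {0<..<1} f (trace_at_time T \<tau> f)"
    unfolding trace_at_time_def by (rule someI[where x = g])
  then show L2: "L2_on {0<..<1} (trace_at_time T \<tau> f)" by (simp add: has_trace_def)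
  from tr obtain w where w: "\<And>n. smooth (w n)" and limw: "H1_tendsto (rect T) w f"
    and trw: "L2_tendsto {0<..<1} (\<lambda>n x. w n (x, \<tau>)) (trace_at_time T \<tau> f)"
    by (auto simp: has_trace_def)
  have limsw: "L2_tendsto (rect T) w f" "L2_tendsto (rect T) (\<lambda>n. pd_t (w n)) (wd_t (rect T) f)"
    using limw by (auto simp: H1_tendsto_def)
  have "(\<lambda>n. sqnorm {0<..<1} (\<lambda>x. z n (x, \<tau>) - w n (x, \<tau>))) \<longlonglongrightarrow> 0"
  proof (rule tendsto_zero_squeeze[OF sqnorm_nonneg bnd[OF z w]])
    show "(\<lambda>n. (1 + T) / T * (sqnorm (rect T) (\<lambda>p. z n p - w n p)
        + sqnorm (rect T) (\<lambda>p. pd_t (z n) p - pd_t (w n) p))) \<longlonglongrightarrow> 0"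
      by (intro tendsto_mult_right_zero tendsto_add_zero
          L2_tendsto_diff_zero[OF rect_borel smooth_L2_on_rect[OF z] smooth_L2_on_rect[OF w] H1_L2_on[OF f] lims(1) limsw(1)]
          L2_tendsto_diff_zero[OF rect_borel smooth_L2_on_rect[OF smooth_pd_t[OF z]]
            smooth_L2_on_rect[OF smooth_pd_t[OF w]] wd_t_L2_on[OF f] lims(2) limsw(2)])
  qed
  then show "L2_tendsto {0<..<1} (\<lambda>n x. z n (x, \<tau>)) (trace_at_time T \<tau> f)"
    by (intro L2_tendsto_perturb[OF _ _ _ L2 trw] smooth_L2_on_slice z w) auto
qed

text \<open>The two trace conditions supply smooth functions \<open>w n\<close> approximating \<open>u\<close> and \<open>v n\<close> approximating
  its derivative in \<open>x\<close>, with restrictions to \<open>x = 0\<close> that tend to zero, but the two sequences are unrelated.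
  The primitives of the \<open>v n\<close> combine them: they vanish on \<open>x = 0\<close>, they approximate \<open>u\<close> by the Poincare
  inequality, and their second derivatives \<open>\<partial>\<^sub>x v n\<close> and \<open>\<partial>\<^sub>t v n\<close> converge as well.  That also their time
  derivatives converge to that of \<open>u\<close> is where closability enters.\<close>

lemma H2_0_approximation:
  assumes T: "0 < T" and u: "u \<in> H2_0 T"
  obtains v where "\<And>n. smooth (v n)" "H1_tendsto (rect T) v (wd_x (rect T) u)"
    "H1_tendsto (rect T) (\<lambda>n. x_primitive (v n)) u"
    "(\<lambda>n. sqnorm {0<..<T} (\<lambda>t. v n (0, t))) \<longlonglongrightarrow> 0"
proof -
  let ?R = "rect T" and ?ux = "wd_x (rect T) u" and ?ut = "wd_t (rect T) u"
  have H: "u \<in> H1 ?R" "?ux \<in> H1 ?R" using u by (auto simp: H2_0_def H2_def)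
  have tr: "has_left_trace T u (\<lambda>_. 0)" "has_left_trace T ?ux (\<lambda>_. 0)" using u by (auto simp: H2_0_def)
  from tr(1) obtain w where w: "\<And>n. smooth (w n)" and limw: "H1_tendsto ?R w u"
    and w0: "L2_tendsto {0<..<T} (\<lambda>n t. w n (0, t)) (\<lambda>_. 0)"
    by (auto simp: has_left_trace_def has_trace_def)
  from tr(2) obtain v where v: "\<And>n. smooth (v n)" and limv: "H1_tendsto ?R v ?ux"
    and v0: "L2_tendsto {0<..<T} (\<lambda>n t. v n (0, t)) (\<lambda>_. 0)"
    by (auto simp: has_left_trace_def has_trace_def)
  have Lw: "L2_tendsto ?R w u" "L2_tendsto ?R (\<lambda>n. pd_x (w n)) ?ux" "L2_tendsto ?R (\<lambda>n. pd_t (w n)) ?ut"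
    and Lv: "L2_tendsto ?R v ?ux" "L2_tendsto ?R (\<lambda>n. pd_t (v n)) (wd_t ?R ?ux)"
    using limw limv by (auto simp: H1_tendsto_def)
  define U where "U n = x_primitive (v n)" for n
  have U: "smooth (U n)" and Ux: "pd_x (U n) = v n" and Ut: "pd_t (U n) = x_primitive (pd_t (v n))"
    and U0: "U n (0, t) = 0" for n t
    unfolding U_def using v by (simp_all add: smooth_x_primitive pd_x_x_primitive pd_t_x_primitive x_primitive_left)
  note L = smooth_L2_on_rect
  define d where "d n = (\<lambda>p. U n p - w n p)" for n
  have d: "smooth (d n)" and dx: "pd_x (d n) = (\<lambda>p. v n p - pd_x (w n) p)"
    and dt: "pd_t (d n) = (\<lambda>p. pd_t (U n) p - pd_t (w n) p)" for n
    unfolding d_def using U w Ux by (simp_all add: smooth_diff pd_x_diff pd_t_diff)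
  have d0: "(\<lambda>n. sqnorm ?R (d n)) \<longlonglongrightarrow> 0"
  proof (rule tendsto_zero_squeeze[OF sqnorm_nonneg poincare_left[OF d less_imp_le[OF T]]])
    have "(\<lambda>n. sqnorm ?R (pd_x (d n))) \<longlonglongrightarrow> 0"
      unfolding dx using Lv Lw
      by (intro L2_tendsto_diff_zero[OF rect_borel L[OF v] L[OF smooth_pd_x[OF w]] wd_x_L2_on[OF H(1)]]) auto
    moreover have "(\<lambda>n. sqnorm {0<..<T} (\<lambda>t. d n (0, t))) \<longlonglongrightarrow> 0"
      using w0 by (simp add: d_def U0 L2_tendsto_sqnorm sqnorm_def)
    ultimately show "(\<lambda>n. exp 2 * (sqnorm ?R (pd_x (d n)) + sqnorm {0<..<T} (\<lambda>t. d n (0, t)))) \<longlonglongrightarrow> 0"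
      by (intro tendsto_mult_right_zero tendsto_add_zero)
  qed
  have dt0: "(\<lambda>n. sqnorm ?R (pd_t (d n))) \<longlonglongrightarrow> 0"
  proof (rule time_derivative_closable[OF T d d0])
    fix e :: real assume e: "e > 0"
    have e4: "e / (4 * exp 2) > 0" "e / 4 > 0" using e by auto
    obtain N1 where N1: "\<And>m n. m \<ge> N1 \<Longrightarrow> n \<ge> N1 \<Longrightarrow>
        sqnorm ?R (\<lambda>p. pd_t (v m) p - pd_t (v n) p) < e / (4 * exp 2)"
      using L2_tendsto_Cauchy[OF rect_borel L[OF smooth_pd_t[OF v]] wd_t_L2_on[OF H(2)] Lv(2) e4(1)] by blast
    obtain N2 where N2: "\<And>m n. m \<ge> N2 \<Longrightarrow> n \<ge> N2 \<Longrightarrow>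
        sqnorm ?R (\<lambda>p. pd_t (w m) p - pd_t (w n) p) < e / 4"
      using L2_tendsto_Cauchy[OF rect_borel L[OF smooth_pd_t[OF w]] wd_t_L2_on[OF H(1)] Lw(3) e4(2)] by blast
    have "sqnorm ?R (\<lambda>p. pd_t (d m) p - pd_t (d n) p) < e" if mn: "m \<ge> max N1 N2" "n \<ge> max N1 N2" for m n
    proof -
      let ?D = "\<lambda>p. pd_t (U m) p - pd_t (U n) p" and ?E = "\<lambda>p. pd_t (w m) p - pd_t (w n) p"
      have sD: "smooth ?D" and sE: "smooth ?E" by (intro smooth_diff smooth_pd_t U w)+
      \<comment> \<open>The time derivatives of the primitives are primitives, hence controlled by the Poincare inequality.\<close>
      have "pd_x ?D = (\<lambda>p. pd_t (v m) p - pd_t (v n) p)"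
        unfolding Ut using v
        by (simp add: pd_x_diff smooth_x_primitive smooth_pd_t pd_x_x_primitive)
      then have "sqnorm ?R ?D \<le> exp 2 * sqnorm ?R (\<lambda>p. pd_t (v m) p - pd_t (v n) p)"
        using poincare_left[OF sD, of T] T by (simp add: Ut x_primitive_left)
      also have "\<dots> < exp 2 * (e / (4 * exp 2))"
        using mn by (intro mult_strict_left_mono N1) auto
      finally have "sqnorm ?R ?D < e / 4" by simp
      moreover have "sqnorm ?R ?E < e / 4" using mn by (intro N2) auto
      moreover have "sqnorm ?R (\<lambda>p. ?D p - ?E p) \<le> 2 * sqnorm ?R ?D + 2 * sqnorm ?R ?E"
        by (intro sqnorm_diff_le rect_borel L sD sE)
      ultimately have "sqnorm ?R (\<lambda>p. ?D p - ?E p) < e" by linarith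
      then show ?thesis by (simp add: dt algebra_simps)
    qed
    then show "\<exists>N. \<forall>m\<ge>N. \<forall>n\<ge>N. sqnorm ?R (\<lambda>p. pd_t (d m) p - pd_t (d n) p) < e" by blast
  qed
  have "L2_tendsto ?R U u"
    using Lw d0 by (intro L2_tendsto_perturb[OF rect_borel L[OF w] L[OF U] H1_L2_on[OF H(1)]]) (auto simp: d_def)
  moreover have "L2_tendsto ?R (\<lambda>n. pd_t (U n)) ?ut"
    using Lw dt0 by (intro L2_tendsto_perturb[OF rect_borel L[OF smooth_pd_t[OF w]] L[OF smooth_pd_t[OF U]]
        wd_t_L2_on[OF H(1)]]) (auto simp: dt)
  moreover have "L2_tendsto ?R (\<lambda>n. pd_x (U n)) ?ux" using Lv by (simp add: Ux)
  ultimately have "H1_tendsto ?R U u" by (simp add: H1_tendsto_def)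
  moreover have "(\<lambda>n. sqnorm {0<..<T} (\<lambda>t. v n (0, t))) \<longlonglongrightarrow> 0"
    using v0 by (simp add: L2_tendsto_sqnorm)
  ultimately show thesis using that[OF v limv] unfolding U_def[abs_def] by blast
qed

section \<open>The Carleman estimate\<close>

theorem theorem4p1:
  fixes \<alpha> :: real
  assumes "0 < \<alpha>" and "\<alpha> < 1 / 2"
  shows "\<exists>C lam0 :: real. C > 0 \<and> lam0 \<ge> 1 \<and>
    (\<forall>T\<ge>2. \<forall>u \<in> H2_0 T. \<forall>lam\<ge>lam0.
      (let R = rect T;
           \<phi> = carleman_weight \<alpha> lam;
           ux = wd_x R u;
           ut = wd_t R u;
           uxx = wd_x R ux;
           uxt = wd_t R ux
       in
        (LINT p:R|lborel. (uxx p - 2 * uxt p)\<^sup>2 * \<phi> p)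
        \<ge> C * lam * (LINT p:R|lborel. ((ux p)\<^sup>2 + (ut p)\<^sup>2) * \<phi> p)
          + C * lam ^ 3 * (LINT p:R|lborel. (u p)\<^sup>2 * \<phi> p)
          + C * lam * (LINT x:{0<..<1}|lborel. (trace_at_time T 0 ux x)\<^sup>2 * exp (- 2 * lam * x))
          + C * lam ^ 3 * (LINT x:{0<..<1}|lborel. (trace_at_time T 0 u x)\<^sup>2 * exp (- 2 * lam * x))
          - C * lam * exp (- 2 * lam * \<alpha> * T) * (LINT x:{0<..<1}|lborel. (trace_at_time T T ux x)\<^sup>2)
          - C * lam ^ 3 * exp (- 2 * lam * \<alpha> * T) * (LINT x:{0<..<1}|lborel. (trace_at_time T T u x)\<^sup>2)))"
proof -
  define \<kappa> where "\<kappa> = 1 - 2 * \<alpha>"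
  have \<kappa>: "0 < \<kappa>" "\<kappa> < 1" using assms by (auto simp: \<kappa>_def)
  have main: "\<kappa> / 2 * lam * (LINT p:rect T|lborel. ((wd_x (rect T) u p)\<^sup>2 + (wd_t (rect T) u p)\<^sup>2)
            * carleman_weight \<alpha> lam p)
          + \<kappa> / 2 * lam ^ 3 * (LINT p:rect T|lborel. (u p)\<^sup>2 * carleman_weight \<alpha> lam p)
          + \<kappa> / 2 * lam * (LINT x:{0<..<1}|lborel.
              (trace_at_time T 0 (wd_x (rect T) u) x)\<^sup>2 * exp (- 2 * lam * x))
          + \<kappa> / 2 * lam ^ 3 * (LINT x:{0<..<1}|lborel. (trace_at_time T 0 u x)\<^sup>2 * exp (- 2 * lam * x))
          - \<kappa> / 2 * lam * exp (- 2 * lam * \<alpha> * T) * (LINT x:{0<..<1}|lborel.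
              (trace_at_time T T (wd_x (rect T) u) x)\<^sup>2)
          - \<kappa> / 2 * lam ^ 3 * exp (- 2 * lam * \<alpha> * T) * (LINT x:{0<..<1}|lborel. (trace_at_time T T u x)\<^sup>2)
        \<le> (LINT p:rect T|lborel. (wd_x (rect T) (wd_x (rect T) u) p - 2 * wd_t (rect T) (wd_x (rect T) u) p)\<^sup>2
            * carleman_weight \<alpha> lam p)"
    if T: "2 \<le> T" and u: "u \<in> H2_0 T" and lam: "3 / \<kappa> \<le> lam" for T lam u
  proof -
    let ?R = "rect T" and ?w = "carleman_weight \<alpha> lam" and ?e = "\<lambda>x::real. exp (- 2 * lam * x)"
    let ?ux = "wd_x ?R u" and ?ut = "wd_t ?R u"
    let ?I = "{0<..<1::real}"
    have T0: "0 < T" using T by simp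
    have H: "u \<in> H1 ?R" "?ux \<in> H1 ?R" using u by (auto simp: H2_0_def H2_def)
    note f = H1_L2_on[OF H(1)] wd_x_L2_on[OF H(1)] wd_t_L2_on[OF H(1)] wd_x_L2_on[OF H(2)] wd_t_L2_on[OF H(2)]
    obtain v where v: "\<And>n. smooth (v n)" and limv: "H1_tendsto ?R v ?ux"
      and limU: "H1_tendsto ?R (\<lambda>n. x_primitive (v n)) u"
      and v0: "(\<lambda>n. sqnorm {0<..<T} (\<lambda>t. v n (0, t))) \<longlonglongrightarrow> 0"
      by (rule H2_0_approximation[OF T0 u]) blast
    let ?U = "\<lambda>n. x_primitive (v n)"
    have U: "smooth (?U n)" for n by (rule smooth_x_primitive[OF v])
    have "3 \<le> 3 / \<kappa>" using \<kappa> by (simp add: field_simps)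
    with lam have l: "0 \<le> lam" by linarith
    have w: "?w \<in> borel_measurable borel"
      by (intro borel_measurable_continuous_onI continuous_carleman_weight)
    have w1: "\<bar>?w p\<bar> \<le> 1" if "p \<in> ?R" for p
      using carleman_weight_le_1[OF _ l that, of \<alpha>] less_imp_le[OF carleman_weight_pos, of \<alpha> lam p] assms by simp
    have e: "?e \<in> borel_measurable borel" by measurable
    have e1: "\<bar>?e x\<bar> \<le> 1" if "x \<in> ?I" for x using that l by simp
    have lims: "L2_tendsto ?R ?U u" "L2_tendsto ?R v ?ux" "L2_tendsto ?R (\<lambda>n. x_primitive (pd_t (v n))) ?ut"
      "L2_tendsto ?R (\<lambda>n. pd_x (v n)) (wd_x ?R ?ux)" "L2_tendsto ?R (\<lambda>n. pd_t (v n)) (wd_t ?R ?ux)"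
      using limv limU by (auto simp: H1_tendsto_def pd_t_x_primitive[OF v])
    note L = smooth_L2_on_rect
    note trU = trace_at_time_limit[OF T0 _ H(1) U limU] and trv = trace_at_time_limit[OF T0 _ H(2) v limv]
    have limF: "(\<lambda>n. LINT p:?R|lborel. (pd_x (v n) p - 2 * pd_t (v n) p)\<^sup>2 * ?w p)
        \<longlonglongrightarrow> (LINT p:?R|lborel. (wd_x ?R ?ux p - 2 * wd_t ?R ?ux p)\<^sup>2 * ?w p)"
    proof (rule weighted_sqnorm_tendsto[OF rect_borel _ _ _ w w1])
      show "L2_tendsto ?R (\<lambda>n p. pd_x (v n) p - 2 * pd_t (v n) p) (\<lambda>p. wd_x ?R ?ux p - 2 * wd_t ?R ?ux p)"
        using L2_tendsto_lincomb[OF rect_borel L[OF smooth_pd_x[OF v]] L[OF smooth_pd_t[OF v]] f(4,5) lims(4,5), of "- 2"]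
        by simp
      show "L2_on ?R (\<lambda>p. pd_x (v n) p - 2 * pd_t (v n) p)" for n
        by (intro L2_on_diff L2_on_cmult L smooth_pd_x smooth_pd_t v rect_borel)
      show "L2_on ?R (\<lambda>p. wd_x ?R ?ux p - 2 * wd_t ?R ?ux p)"
        by (intro L2_on_diff L2_on_cmult f rect_borel)
    qed
    have limR: "(\<lambda>n. LINT p:?R|lborel. (g n p)\<^sup>2 * ?w p) \<longlonglongrightarrow> (LINT p:?R|lborel. (h p)\<^sup>2 * ?w p)"
      if "\<And>n. smooth (g n)" "L2_on ?R h" "L2_tendsto ?R g h" for g h
      by (rule weighted_sqnorm_tendsto[OF rect_borel L[OF that(1)] that(2,3) w w1])
    have limE: "(\<lambda>n. LINT x:?I|lborel. (g n (x, \<tau>))\<^sup>2 * ?e x) \<longlonglongrightarrow> (LINT x:?I|lborel. (h x)\<^sup>2 * ?e x)"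
      and lim1: "(\<lambda>n. sqnorm ?I (\<lambda>x. g n (x, \<tau>))) \<longlonglongrightarrow> sqnorm ?I h"
      if g: "\<And>n. smooth (g n)" and h: "L2_on ?I h" and lim: "L2_tendsto ?I (\<lambda>n x. g n (x, \<tau>)) h" for g h \<tau>
      using weighted_sqnorm_tendsto[OF _ smooth_L2_on_slice(1)[OF g] h lim e e1]
        weighted_sqnorm_tendsto[OF _ smooth_L2_on_slice(1)[OF g] h lim borel_measurable_const, of 1 1]
      by (simp_all add: sqnorm_def)
    let ?lhs = "\<kappa> / 2 * lam * (LINT p:?R|lborel. (?ux p)\<^sup>2 * ?w p)
      + \<kappa> / 2 * lam * (LINT p:?R|lborel. (?ut p)\<^sup>2 * ?w p)
      + \<kappa> / 2 * lam ^ 3 * (LINT p:?R|lborel. (u p)\<^sup>2 * ?w p)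
      + \<kappa> / 2 * lam * (LINT x:?I|lborel. (trace_at_time T 0 ?ux x)\<^sup>2 * ?e x)
      + \<kappa> / 2 * lam ^ 3 * (LINT x:?I|lborel. (trace_at_time T 0 u x)\<^sup>2 * ?e x)"
    let ?rhs = "(LINT p:?R|lborel. (wd_x ?R ?ux p - 2 * wd_t ?R ?ux p)\<^sup>2 * ?w p)
      + lam * 0
      + \<kappa> / 2 * lam * exp (- 2 * lam * \<alpha> * T) * sqnorm ?I (trace_at_time T T ?ux)
      + \<kappa> / 2 * lam ^ 3 * exp (- 2 * lam * \<alpha> * T) * sqnorm ?I (trace_at_time T T u)"
    have "?lhs \<le> ?rhs"
    proof (rule tendsto_le[OF trivial_limit_sequentially _ _ always_eventually[OF allI]])
      show "(\<lambda>n. (LINT p:?R|lborel. (pd_x (v n) p - 2 * pd_t (v n) p)\<^sup>2 * ?w p)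
          + lam * sqnorm {0<..<T} (\<lambda>t. v n (0, t))
          + \<kappa> / 2 * lam * exp (- 2 * lam * \<alpha> * T) * sqnorm ?I (\<lambda>x. v n (x, T))
          + \<kappa> / 2 * lam ^ 3 * exp (- 2 * lam * \<alpha> * T) * sqnorm ?I (\<lambda>x. ?U n (x, T))) \<longlonglongrightarrow> ?rhs"
        by (intro tendsto_add tendsto_mult_left limF v0 lim1 v U trU trv) auto
      show "(\<lambda>n. \<kappa> / 2 * lam * (LINT p:?R|lborel. (v n p)\<^sup>2 * ?w p)
          + \<kappa> / 2 * lam * (LINT p:?R|lborel. (x_primitive (pd_t (v n)) p)\<^sup>2 * ?w p)
          + \<kappa> / 2 * lam ^ 3 * (LINT p:?R|lborel. (?U n p)\<^sup>2 * ?w p)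
          + \<kappa> / 2 * lam * (LINT x:?I|lborel. (v n (x, 0))\<^sup>2 * ?e x)
          + \<kappa> / 2 * lam ^ 3 * (LINT x:?I|lborel. (?U n (x, 0))\<^sup>2 * ?e x)) \<longlonglongrightarrow> ?lhs"
        by (intro tendsto_add tendsto_mult_left limR limE v U smooth_x_primitive smooth_pd_t f lims trU trv) auto
      fix n
      show "\<kappa> / 2 * lam * (LINT p:?R|lborel. (v n p)\<^sup>2 * ?w p)
          + \<kappa> / 2 * lam * (LINT p:?R|lborel. (x_primitive (pd_t (v n)) p)\<^sup>2 * ?w p)
          + \<kappa> / 2 * lam ^ 3 * (LINT p:?R|lborel. (?U n p)\<^sup>2 * ?w p)
          + \<kappa> / 2 * lam * (LINT x:?I|lborel. (v n (x, 0))\<^sup>2 * ?e x)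
          + \<kappa> / 2 * lam ^ 3 * (LINT x:?I|lborel. (?U n (x, 0))\<^sup>2 * ?e x)
        \<le> (LINT p:?R|lborel. (pd_x (v n) p - 2 * pd_t (v n) p)\<^sup>2 * ?w p)
          + lam * sqnorm {0<..<T} (\<lambda>t. v n (0, t))
          + \<kappa> / 2 * lam * exp (- 2 * lam * \<alpha> * T) * sqnorm ?I (\<lambda>x. v n (x, T))
          + \<kappa> / 2 * lam ^ 3 * exp (- 2 * lam * \<alpha> * T) * sqnorm ?I (\<lambda>x. ?U n (x, T))"
        by (rule smooth_carleman_estimate[OF v assms \<kappa>_def lam less_imp_le[OF T0]])
    qed
    moreover have "(LINT p:?R|lborel. ((?ux p)\<^sup>2 + (?ut p)\<^sup>2) * ?w p)
        = (LINT p:?R|lborel. (?ux p)\<^sup>2 * ?w p) + (LINT p:?R|lborel. (?ut p)\<^sup>2 * ?w p)"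
      unfolding distrib_right
      by (rule set_integral_add(2)[OF L2_on_weight_integrable[OF rect_borel f(2) w w1]
            L2_on_weight_integrable[OF rect_borel f(3) w w1]])
    ultimately show ?thesis unfolding sqnorm_def by (simp add: distrib_left)
  qed
  have "1 \<le> 3 / \<kappa>" using \<kappa> by (simp add: field_simps)
  then show ?thesis
    unfolding Let_def
    by (intro exI[of _ "\<kappa> / 2"] exI[of _ "3 / \<kappa>"] conjI ballI allI impI main) (use \<kappa> in auto)
qed

end
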